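(* Suppose the random walk $x(t)$ has a limiting stable law with parameter $\alpha$, where $0<\alpha<1$ if $d=1$ and $0<\alpha<2$ if $d\ge2$; i.e. $\frac{x(t)}{t^{1/\alpha}}$ converges in distribution, as $t\to\infty$, to a (symmetric, non-degenerate $d$-dimensional) stable distribution $St_\alpha$ with parameter $\alpha$. Suppose also $\sum_{x\in\mathbb{Z}^d}|B(x)|^{d/\alpha}<\infty$. Then there exists $\varkappa_{cr}>0$ such that $N_0(B)\ge1$ for $\varkappa<\varkappa_{cr}$ and $N_0(B)=0$ for $\varkappa>\varkappa_{cr}$.
   Context: $\varkappa>0$. The kernel $a:\mathbb{Z}^d\to[0,\infty)$ satisfies $a(z)=a(-z)$, $a(0)=0$, $a(z)>0$ if $|z|=1$, $\sum_za(z)=1$; $\mathcal{A}f(x)=\sum_{z\ne0}a(z)(f(x+z)-f(x))$. $x(t)$ is the continuous-time random walk on $\mathbb{Z}^d$ with generator $2\varkappa\mathcal{A}$ (the hypothesis does not depend on $\varkappa$ up to scaling of the limit law). $\mathcal{H}_2=2\varkappa\mathcal{A}+B(x)$ on $l^2(\mathbb{Z}^d)$, where $B$ acts by multiplication and is the correlation function $B(x)=\sum_zb(x-z)b(-z)$ with $b:\mathbb{Z}^d\to\mathbb{R}$, $\sum_z|b(z)|<\infty$, $B(0)>0$. $N_0(B)$ is the number of positive eigenvalues (counted with multiplicity) of $\mathcal{H}_2$. *)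

theory Defs
  imports "HOL-Probability.Probability" "HOL-Library.Function_Algebras"
begin

text \<open>The lattice is the type \<open>int ^ 'd\<close>, of dimension \<open>CARD('d)\<close>.\<close>

definition real_vec :: "int ^ 'd \<Rightarrow> real ^ 'd" where
  "real_vec z = (\<chi> i. real_of_int (z $ i))"

definition rw_kernel :: "(int ^ 'd \<Rightarrow> real) \<Rightarrow> bool" where
  "rw_kernel a \<longleftrightarrow>
     (\<forall>z. 0 \<le> a z) \<and> (\<forall>z. a z = a (- z)) \<and> a 0 = 0 \<and>
     (\<forall>z. norm (real_vec z) = 1 \<longrightarrow> 0 < a z) \<and> (a has_sum 1) UNIV"

text \<open>For bounded \<open>f\<close> (in particular for square-summable \<open>f\<close>) the sum converges absolutely.\<close>

definition rw_generator ::
  "(int ^ 'd \<Rightarrow> real) \<Rightarrow> (int ^ 'd \<Rightarrow> complex) \<Rightarrow> int ^ 'd \<Rightarrow> complex" where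
  "rw_generator a f x = (\<Sum>\<^sub>\<infinity>z\<in>- {0}. of_real (a z) * (f (x + z) - f x))"

text \<open>
  The continuous-time random walk with generator \<open>c \<A>\<close> started at the origin: a process with
  independent stationary increments and right-continuous step paths, whose transition semigroup
  \<open>(P t f) x = E f (x + X t)\<close> on bounded functions with the supremum norm has derivative
  \<open>c \<A>\<close> at \<open>t = 0\<close>. Only the values of \<open>X t\<close> for \<open>t \<ge> 0\<close> matter.
\<close>

definition random_walk ::
  "real \<Rightarrow> (int ^ 'd \<Rightarrow> real) \<Rightarrow> 'w measure \<Rightarrow> (real \<Rightarrow> 'w \<Rightarrow> int ^ 'd) \<Rightarrow> bool" where
  "random_walk c a M X \<longleftrightarrow>
     prob_space M \<and>
     (\<forall>t\<ge>0. X t \<in> M \<rightarrow>\<^sub>M count_space UNIV) \<and>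
     (AE \<omega> in M. X 0 \<omega> = 0) \<and>
     (\<forall>(ts :: nat \<Rightarrow> real) n. 0 \<le> ts 0 \<and> mono ts \<longrightarrow>
        prob_space.indep_vars M (\<lambda>_. count_space UNIV)
          (\<lambda>i \<omega>. X (ts (Suc i)) \<omega> - X (ts i) \<omega>) {..<n}) \<and>
     (\<forall>s\<ge>0. \<forall>t\<ge>0. distr M (count_space UNIV) (\<lambda>\<omega>. X (s + t) \<omega> - X s \<omega>)
                  = distr M (count_space UNIV) (X t)) \<and>
     (AE \<omega> in M. \<forall>t\<ge>0. \<exists>\<epsilon>>0. \<forall>s\<in>{t..<t + \<epsilon>}. X s \<omega> = X t \<omega>) \<and>
     (\<forall>f :: int ^ 'd \<Rightarrow> complex. bounded (range f) \<longrightarrow>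
        uniform_limit UNIV
          (\<lambda>t x. ((\<integral>\<omega>. f (x + X t \<omega>) \<partial>M) - f x) / of_real t)
          (\<lambda>x. of_real c * rw_generator a f x) (at_right 0))"

definition converges_in_distribution ::
  "'w measure \<Rightarrow> (real \<Rightarrow> 'w \<Rightarrow> 'a::topological_space) \<Rightarrow> 'a measure \<Rightarrow> bool" where
  "converges_in_distribution M Y \<mu> \<longleftrightarrow>
     (\<forall>f :: 'a \<Rightarrow> real. continuous_on UNIV f \<and> bounded (range f) \<longrightarrow>
        ((\<lambda>t. \<integral>\<omega>. f (Y t \<omega>) \<partial>M) \<longlongrightarrow> (\<integral>x. f x \<partial>\<mu>)) at_top)"

text \<open>
  Stability with index \<open>\<alpha>\<close>: if \<open>U\<close>, \<open>V\<close> are independent with law \<open>\<mu>\<close>, then for all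
  \<open>p, q > 0\<close> the vector \<open>p U + q V\<close> is distributed as
  \<open>(p powr \<alpha> + q powr \<alpha>) powr (1 / \<alpha>) U + D\<close> for some constant vector \<open>D\<close>.
\<close>

definition stable_law :: "real \<Rightarrow> 'a::euclidean_space measure \<Rightarrow> bool" where
  "stable_law \<alpha> \<mu> \<longleftrightarrow>
     prob_space \<mu> \<and> sets \<mu> = sets borel \<and>
     (\<forall>p>0. \<forall>q>0. \<exists>D.
        distr (\<mu> \<Otimes>\<^sub>M \<mu>) borel (\<lambda>(u, v). p *\<^sub>R u + q *\<^sub>R v)
      = distr \<mu> borel (\<lambda>u. ((p powr \<alpha> + q powr \<alpha>) powr (1 / \<alpha>)) *\<^sub>R u + D))"

definition symmetric_law :: "'a::euclidean_space measure \<Rightarrow> bool" where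
  "symmetric_law \<mu> \<longleftrightarrow> distr \<mu> borel uminus = \<mu>"

text \<open>Not concentrated on an affine hyperplane.\<close>

definition nondegenerate_law :: "'a::euclidean_space measure \<Rightarrow> bool" where
  "nondegenerate_law \<mu> \<longleftrightarrow> (\<forall>v c. v \<noteq> 0 \<longrightarrow> \<not> (AE x in \<mu>. v \<bullet> x = c))"

definition correlation :: "(int ^ 'd \<Rightarrow> real) \<Rightarrow> int ^ 'd \<Rightarrow> real" where
  "correlation b x = (\<Sum>\<^sub>\<infinity>z. b (x - z) * b (- z))"

definition l2 :: "('x \<Rightarrow> complex) set" where
  "l2 = {f. (\<lambda>x. (cmod (f x))\<^sup>2) summable_on UNIV}"

definition H2 :: "real \<Rightarrow> (int ^ 'd \<Rightarrow> real) \<Rightarrow> (int ^ 'd \<Rightarrow> real) \<Rightarrow>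
    (int ^ 'd \<Rightarrow> complex) \<Rightarrow> int ^ 'd \<Rightarrow> complex" where
  "H2 \<kappa> a B f x = of_real (2 * \<kappa>) * rw_generator a f x + of_real (B x) * f x"

definition eigenspace ::
  "(('x \<Rightarrow> complex) \<Rightarrow> 'x \<Rightarrow> complex) \<Rightarrow> real \<Rightarrow> ('x \<Rightarrow> complex) set" where
  "eigenspace H \<mu> = {f \<in> l2. \<forall>x. H f x = of_real \<mu> * f x}"

global_interpretation cfun: vector_space "\<lambda>(c::complex) (f::'x \<Rightarrow> complex) x. c * f x"
  by unfold_locales (auto simp: fun_eq_iff algebra_simps)

text \<open>The dimension of the eigenspace, with value \<open>\<infinity>\<close> in the infinite-dimensional case
  (where \<open>cfun.dim\<close> would be \<open>0\<close>); it is \<open>0\<close> if \<open>\<mu>\<close> is not an eigenvalue.\<close>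

definition multiplicity_of ::
  "(('x \<Rightarrow> complex) \<Rightarrow> 'x \<Rightarrow> complex) \<Rightarrow> real \<Rightarrow> enat" where
  "multiplicity_of H \<mu> =
     (SUP S\<in>{S. S \<subseteq> eigenspace H \<mu> \<and> finite S \<and> cfun.independent S}. enat (card S))"

definition N0 :: "real \<Rightarrow> (int ^ 'd \<Rightarrow> real) \<Rightarrow> (int ^ 'd \<Rightarrow> real) \<Rightarrow> enat" where
  "N0 \<kappa> a B = (\<Sum>\<^sub>\<infinity>\<mu>\<in>{0<..}. multiplicity_of (H2 \<kappa> a B) \<mu>)"

end

theory Submission
  imports Defs "HOL-Real_Asymp.Real_Asymp"
begin

text \<open>
  The theorem rests on the variational description of positive eigenvalues. There is a positive
  eigenvalue exactly if the quadratic form of \<open>2 \<kappa> \<A> + B\<close> is positive at some finitely supported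
  function \<open>f\<close>, that is, if \<open>2 \<kappa> D(f) < \<Sum> B f\<^sup>2\<close>, where \<open>D\<close> is the Dirichlet form of the walk
  (\<open>positive_eigenfunction_exists\<close>, \<open>quadratic_form_positive_of_eigenfunction\<close>). Since \<open>D \<ge> 0\<close>, the set
  of all \<open>\<kappa>\<close> with this property is an initial segment of the positive half line, and it contains
  all small \<open>\<kappa>\<close> because \<open>B 0 > 0\<close>. What remains is to show that it is bounded.

  This holds because the walk is transient: there is a constant \<open>K\<close> with \<open>f(x)\<^sup>2 \<le> K D(f)\<close> for all
  finitely supported \<open>f\<close> and all \<open>x\<close> (\<open>dirichlet_pointwise_bound\<close>). As a correlation of a summable
  function, \<open>B\<close> is summable, so \<open>\<Sum> B f\<^sup>2 \<le> K (\<Sum> \<bar>B\<bar>) D(f)\<close>, and no \<open>\<kappa> \<ge> K (\<Sum> \<bar>B\<bar>) / 2\<close> belongs to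
  the set. By the Cauchy-Schwarz inequality in Fourier space, \<open>K\<close> exists once the reciprocal of the symbol
  \<open>\<psi>(\<theta>) = \<Sum> a(z) (1 - cos (\<theta> \<bullet> z))\<close> is integrable over the cube \<open>[-pi, pi]\<^sup>d\<close>.

  The limit law provides this integrability. The characteristic function at time \<open>t\<close> of the walk with generator \<open>c \<A>\<close> is
  \<open>exp (- c t \<psi>)\<close> (\<open>random_walk_cf\<close>), so the convergence in distribution determines the behaviour of \<open>\<psi>\<close>
  at the origin along every ray: \<open>\<psi>(r \<xi>) / r powr \<alpha>\<close> tends to a limit, which is finite and positive as
  the limit law is not degenerate (\<open>symb_ray_asymptotics\<close>). Subadditivity of the square root of \<open>\<psi>\<close> and
  compactness of the sphere make this uniform, and \<open>\<psi>(\<theta>) \<ge> C \<bar>\<theta>\<bar> powr \<alpha>\<close> follows on the cube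
  (\<open>symb_lower\<close>). Finally \<open>\<bar>\<theta>\<bar> powr (- \<alpha>)\<close> is integrable there because \<open>\<alpha> < d\<close>.
\<close>

section \<open>The step distribution and its symbol\<close>

lemma rw_kernel_pmf:
  assumes "rw_kernel a"
  obtains P where "pmf P = a"
proof -
  have nonneg: "0 \<le> a z" for z
    using assms by (simp add: rw_kernel_def)
  have sum1: "(a has_sum 1) UNIV"
    using assms by (simp add: rw_kernel_def)
  have abs: "Infinite_Sum.abs_summable_on a UNIV"
    using has_sum_imp_summable[OF sum1] nonneg by simp
  have int: "integrable (count_space UNIV) a"
    using iffD1[OF abs_summable_equivalent abs] by (simp only: abs_summable_on_def)
  have "(\<integral>\<^sup>+z. ennreal (a z) \<partial>count_space UNIV) = ennreal (\<integral>z. a z \<partial>count_space UNIV)"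
    using int nonneg by (intro nn_integral_eq_integral) auto
  also have "(\<integral>z. a z \<partial>count_space UNIV) = infsum a UNIV"
    using infsetsum_infsum[OF iffD1[OF abs_summable_equivalent abs]] by (simp add: infsetsum_def)
  also have "infsum a UNIV = 1"
    using sum1 by (simp add: infsumI)
  finally have "(\<integral>\<^sup>+z. ennreal (a z) \<partial>count_space UNIV) = 1"
    by simp
  then have "pmf (embed_pmf a) = a"
    using nonneg by (auto simp: pmf_embed_pmf)
  then show ?thesis
    using that by blast
qed

lemma integrable_pmf_bounded:
  fixes f :: "'a \<Rightarrow> 'b::{banach, second_countable_topology}"
  assumes "\<And>x. norm (f x) \<le> C"
  shows "integrable (measure_pmf P) f"
  by (rule measure_pmf.integrable_const_bound[where B = C]) (use assms in auto)

lemma expectation_eq_infsum: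
  fixes f :: "'a \<Rightarrow> complex"
  assumes "\<And>x. norm (f x) \<le> C"
  shows "(\<lambda>x. of_real (pmf P x) * f x) summable_on UNIV"
    and "measure_pmf.expectation P f = (\<Sum>\<^sub>\<infinity>x. of_real (pmf P x) * f x)"
proof -
  have "integrable (measure_pmf P) f"
    using assms by (rule integrable_pmf_bounded)
  then have int: "integrable (count_space UNIV) (\<lambda>x. of_real (pmf P x) * f x)"
    unfolding measure_pmf_eq_density by (subst (asm) integrable_density) (auto simp: scaleR_conv_of_real)
  then have abs: "Infinite_Set_Sum.abs_summable_on (\<lambda>x. of_real (pmf P x) * f x) UNIV"
    by (simp only: abs_summable_on_def)
  have "Infinite_Sum.abs_summable_on (\<lambda>x. of_real (pmf P x) * f x) UNIV"
    using abs by (rule iffD2[OF abs_summable_equivalent])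
  then show "(\<lambda>x. of_real (pmf P x) * f x) summable_on UNIV"
    by (rule abs_summable_summable)
  have "measure_pmf.expectation P f = (\<integral>x. of_real (pmf P x) * f x \<partial>count_space UNIV)"
    unfolding measure_pmf_eq_density by (subst integral_density) (auto simp: scaleR_conv_of_real)
  also have "\<dots> = (\<Sum>\<^sub>\<infinity>x. of_real (pmf P x) * f x)"
    using infsetsum_infsum[OF abs] by (simp add: infsetsum_def)
  finally show "measure_pmf.expectation P f = (\<Sum>\<^sub>\<infinity>x. of_real (pmf P x) * f x)" .
qed

text \<open>
  On bounded functions the generator is the expected increment over one step; the excluded
  summand \<open>z = 0\<close> vanishes.
\<close>

lemma rw_generator_expectation:
  fixes f :: "int ^ 'd \<Rightarrow> complex"
  assumes "\<And>x. norm (f x) \<le> C"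
  shows "rw_generator (pmf P) f x = measure_pmf.expectation P (\<lambda>z. f (x + z)) - f x"
proof -
  have bound: "norm (f (x + z) - f x) \<le> 2 * C" for z
    using norm_triangle_ineq4[of "f (x + z)" "f x"] assms[of "x + z"] assms[of x] by linarith
  have "rw_generator (pmf P) f x = (\<Sum>\<^sub>\<infinity>z. of_real (pmf P z) * (f (x + z) - f x))"
    unfolding rw_generator_def by (rule infsum_cong_neutral) auto
  also have "\<dots> = measure_pmf.expectation P (\<lambda>z. f (x + z) - f x)"
    using bound by (rule expectation_eq_infsum(2)[symmetric])
  also have "\<dots> = measure_pmf.expectation P (\<lambda>z. f (x + z)) - f x"
    using integrable_pmf_bounded[of "\<lambda>z. f (x + z)", OF assms]
    by (subst Bochner_Integration.integral_diff) auto
  finally show ?thesis .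
qed

text \<open>
  Invariance of the step distribution under reflection in the origin.
\<close>

definition symmetric_pmf :: "(int ^ 'd) pmf \<Rightarrow> bool" where
  "symmetric_pmf P \<longleftrightarrow> (\<forall>z. pmf P (- z) = pmf P z)"

lemma symmetric_pmf_map: "symmetric_pmf P \<Longrightarrow> map_pmf uminus P = P"
  by (rule pmf_eqI) (metis pmf_map_inj' inj_uminus symmetric_pmf_def minus_minus)

lemma symmetric_pmf_expectation:
  fixes f :: "int ^ 'd \<Rightarrow> 'b::{banach, second_countable_topology}"
  assumes "symmetric_pmf P"
  shows "measure_pmf.expectation P (\<lambda>z. f (- z)) = measure_pmf.expectation P f"
proof -
  have "measure_pmf.expectation P f = measure_pmf.expectation (map_pmf uminus P) f"
    by (simp add: symmetric_pmf_map[OF assms])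
  then show ?thesis
    by simp
qed

lemma cis_sum: "finite I \<Longrightarrow> cis (\<Sum>i\<in>I. f i) = (\<Prod>i\<in>I. cis (f i))"
  by (induction I rule: finite_induct) (auto simp: cis_mult[symmetric])

text \<open>
  The symbol \<open>1 - E cos (\<xi> \<bullet> Z)\<close> of minus the generator, where \<open>Z\<close> is one step. It is defined for
  every step distribution; for a symmetric one it is \<open>1\<close> minus the characteristic function of \<open>Z\<close>.
\<close>

definition symb :: "(int ^ 'd) pmf \<Rightarrow> real ^ 'd \<Rightarrow> real" where
  "symb P \<xi> = measure_pmf.expectation P (\<lambda>z. 1 - cos (\<xi> \<bullet> real_vec z))"

lemma real_vec_simps [simp]:
  "real_vec 0 = 0" "real_vec (- z) = - real_vec z"
  "real_vec (x + y) = real_vec x + real_vec y" "real_vec (x - y) = real_vec x - real_vec y"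
  by (simp_all add: real_vec_def vec_eq_iff)

lemma abs_cos_expr_le: "norm (1 - cos (x::real)) \<le> 2"
  using cos_ge_minus_one[of x] cos_le_one[of x] by simp

lemma integrable_symb [intro, simp]:
  "integrable (measure_pmf P) (\<lambda>z. 1 - cos (\<xi> \<bullet> real_vec z))"
  by (rule integrable_pmf_bounded[OF abs_cos_expr_le])

lemma integrable_cos_pmf [intro, simp]:
  fixes g :: "_ \<Rightarrow> real"
  shows "integrable (measure_pmf P) (\<lambda>z. cos (g z))"
  by (rule integrable_pmf_bounded[where C = 1]) auto

lemma integrable_cis_pmf [intro, simp]:
  "integrable (measure_pmf P) (\<lambda>z. cis (g z))"
  by (rule integrable_pmf_bounded[where C = 1]) auto

lemma symb_nonneg: "0 \<le> symb P \<xi>"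
  unfolding symb_def by (intro integral_nonneg_AE) auto

lemma symb_minus: "symb P (- \<xi>) = symb P \<xi>"
  by (simp add: symb_def)

lemma symb_0 [simp]: "symb P 0 = 0"
  by (simp add: symb_def)

lemma symb_eq: "symb P \<xi> = 1 - measure_pmf.expectation P (\<lambda>z. cos (\<xi> \<bullet> real_vec z))"
  unfolding symb_def by (subst Bochner_Integration.integral_diff) auto

text \<open>The square root of the symbol is subadditive; this weaker form suffices.\<close>

lemma symb_add_le: "symb P (\<xi> + \<eta>) \<le> 2 * symb P \<xi> + 2 * symb P \<eta>"
proof -
  have key: "1 - cos (x + y) \<le> 2 * (1 - cos x) + 2 * (1 - cos y)" for x y :: real
  proof -
    have dbl: "1 - cos t = 2 * (sin (t / 2))\<^sup>2" for t :: real
      using cos_double_sin[of "t / 2"] by simp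
    have "\<bar>sin (x / 2 + y / 2)\<bar> \<le> \<bar>sin (x / 2)\<bar> + \<bar>sin (y / 2)\<bar>"
    proof -
      have "\<bar>sin (x / 2 + y / 2)\<bar> \<le> \<bar>sin (x / 2) * cos (y / 2)\<bar> + \<bar>cos (x / 2) * sin (y / 2)\<bar>"
        by (simp add: sin_add)
      also have "\<dots> \<le> \<bar>sin (x / 2)\<bar> * 1 + 1 * \<bar>sin (y / 2)\<bar>"
        unfolding abs_mult by (intro add_mono mult_mono) auto
      finally show ?thesis by simp
    qed
    then have "(sin (x / 2 + y / 2))\<^sup>2 \<le> (\<bar>sin (x / 2)\<bar> + \<bar>sin (y / 2)\<bar>)\<^sup>2"
      by (metis abs_ge_zero power2_abs power_mono)
    also have "\<dots> \<le> 2 * (sin (x / 2))\<^sup>2 + 2 * (sin (y / 2))\<^sup>2"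
      using sum_squares_bound[of "\<bar>sin (x / 2)\<bar>" "\<bar>sin (y / 2)\<bar>"]
      by (simp add: power2_sum)
    finally show ?thesis
      by (simp add: dbl add_divide_distrib)
  qed
  have "symb P (\<xi> + \<eta>) \<le> measure_pmf.expectation P
      (\<lambda>z. 2 * (1 - cos (\<xi> \<bullet> real_vec z)) + 2 * (1 - cos (\<eta> \<bullet> real_vec z)))"
    unfolding symb_def
  proof (rule integral_mono)
    show "integrable (measure_pmf P)
      (\<lambda>z. 2 * (1 - cos (\<xi> \<bullet> real_vec z)) + 2 * (1 - cos (\<eta> \<bullet> real_vec z)))"
      by (intro Bochner_Integration.integrable_add integrable_mult_right integrable_symb)
  qed (auto simp only: inner_add_left intro!: key)
  also have "\<dots> = 2 * symb P \<xi> + 2 * symb P \<eta>"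
    unfolding symb_def
    by (subst Bochner_Integration.integral_add)
       (auto intro: integrable_mult_right integrable_symb simp del: right_diff_distrib_numeral)
  finally show ?thesis .
qed

lemma expectation_cis:
  assumes "symmetric_pmf P"
  shows "measure_pmf.expectation P (\<lambda>z. cis (\<xi> \<bullet> real_vec z)) = of_real (1 - symb P \<xi>)"
proof (rule complex_eqI)
  show "Re (measure_pmf.expectation P (\<lambda>z. cis (\<xi> \<bullet> real_vec z))) = Re (of_real (1 - symb P \<xi>))"
    by (subst integral_Re[symmetric]) (auto simp: symb_eq)
  have "measure_pmf.expectation P (\<lambda>z. sin (\<xi> \<bullet> real_vec z))
      = measure_pmf.expectation P (\<lambda>z. sin (\<xi> \<bullet> real_vec (- z)))"
    by (rule symmetric_pmf_expectation[OF assms, symmetric])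
  then have "measure_pmf.expectation P (\<lambda>z. sin (\<xi> \<bullet> real_vec z)) = 0"
    by simp
  then show "Im (measure_pmf.expectation P (\<lambda>z. cis (\<xi> \<bullet> real_vec z))) = Im (of_real (1 - symb P \<xi>))"
    by (subst integral_Im[symmetric]) auto
qed

lemma symb_lower_coordinate:
  "pmf P (axis i 1) * (1 - cos (\<xi> $ i)) \<le> symb P \<xi>"
proof -
  have "pmf P (axis i 1) * (1 - cos (\<xi> $ i)) =
      measure_pmf.expectation P (\<lambda>z. indicator {axis i 1} z * (1 - cos (\<xi> $ i)))"
    by (simp add: measure_pmf_single)
  also have "\<dots> \<le> symb P \<xi>"
    unfolding symb_def
  proof (rule integral_mono)
    fix z :: "int ^ 'a"
    have "real_vec (axis i 1 :: int ^ 'a) = axis i 1"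
      by (simp add: real_vec_def axis_def vec_eq_iff)
    then show "indicator {axis i 1} z * (1 - cos (\<xi> $ i)) \<le> 1 - cos (\<xi> \<bullet> real_vec z)"
      by (auto simp: indicator_def inner_axis)
  qed (auto intro!: integrable_pmf_bounded[where C = 2] abs_cos_expr_le simp: indicator_def)
  finally show ?thesis .
qed

section \<open>The characteristic function of the walk\<close>

text \<open>
  The increments over \<open>n\<close> steps of length \<open>t / n\<close> are independent and identically distributed, so
  the characteristic function at time \<open>t\<close> is an \<open>n\<close>-th power.
\<close>

lemma random_walk_cf_power:
  fixes X :: "real \<Rightarrow> 'w \<Rightarrow> int ^ 'd"
  assumes walk: "random_walk c a M X" and t: "0 \<le> t" and n: "0 < (n::nat)"
  shows "(\<integral>\<omega>. cis (\<xi> \<bullet> real_vec (X t \<omega>)) \<partial>M) = (\<integral>\<omega>. cis (\<xi> \<bullet> real_vec (X (t / n) \<omega>)) \<partial>M) ^ n"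
proof -
  interpret prob_space M
    using walk by (simp add: random_walk_def)
  have X_meas: "X s \<in> M \<rightarrow>\<^sub>M count_space UNIV" if "0 \<le> s" for s
    using walk that by (simp add: random_walk_def)
  have X0: "AE \<omega> in M. X 0 \<omega> = 0"
    using walk by (simp add: random_walk_def)
  have stationary: "distr M (count_space UNIV) (\<lambda>\<omega>. X (s + u) \<omega> - X s \<omega>) = distr M (count_space UNIV) (X u)"
    if "0 \<le> s" "0 \<le> u" for s u
    using walk that unfolding random_walk_def by blast
  define F :: "int ^ 'd \<Rightarrow> complex" where "F = (\<lambda>y. cis (\<xi> \<bullet> real_vec y))"
  define ts :: "nat \<Rightarrow> real" where "ts = (\<lambda>i. i * (t / n))"
  have ts_Suc: "ts (Suc i) = ts i + t / n" for i
    by (simp add: ts_def algebra_simps add_divide_distrib)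
  have ts_nonneg: "0 \<le> ts i" for i
    using t by (simp add: ts_def)
  have "mono ts"
    unfolding ts_def using t by (intro monoI mult_right_mono) auto
  then have indep: "indep_vars (\<lambda>_. count_space UNIV) (\<lambda>i \<omega>. X (ts (Suc i)) \<omega> - X (ts i) \<omega>) {..<n}"
    using walk ts_nonneg unfolding random_walk_def by blast
  have indepF: "indep_vars (\<lambda>_. borel) (\<lambda>i \<omega>. F (X (ts (Suc i)) \<omega> - X (ts i) \<omega>)) {..<n}"
    using indep_vars_compose2[OF indep, of "\<lambda>_. F" "\<lambda>_. borel"] by simp
  have incr_meas: "(\<lambda>\<omega>. X (ts (Suc i)) \<omega> - X (ts i) \<omega>) \<in> M \<rightarrow>\<^sub>M count_space UNIV" for i
  proof (cases "i < n")
    case True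
    then show ?thesis
      using indep unfolding indep_vars_def by blast
  next
    case False
    have "mono ts"
      by fact
    then have "indep_vars (\<lambda>_. count_space UNIV) (\<lambda>i \<omega>. X (ts (Suc i)) \<omega> - X (ts i) \<omega>) {..<Suc i}"
      using walk ts_nonneg unfolding random_walk_def by blast
    then show ?thesis
      unfolding indep_vars_def by blast
  qed
  have integrable: "integrable M (\<lambda>\<omega>. F (X (ts (Suc i)) \<omega> - X (ts i) \<omega>))" for i
  proof (rule integrable_const_bound[where B = 1])
    show "(\<lambda>\<omega>. F (X (ts (Suc i)) \<omega> - X (ts i) \<omega>)) \<in> borel_measurable M"
      by (rule measurable_compose[OF incr_meas]) simp
  qed (simp add: F_def)
  have "(\<integral>\<omega>. F (X t \<omega>) \<partial>M) = (\<integral>\<omega>. (\<Prod>i<n. F (X (ts (Suc i)) \<omega> - X (ts i) \<omega>)) \<partial>M)"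
  proof (rule integral_cong_AE)
    show "(\<lambda>\<omega>. F (X t \<omega>)) \<in> borel_measurable M"
      by (rule measurable_compose[OF X_meas[OF t]]) simp
    show "(\<lambda>\<omega>. \<Prod>i<n. F (X (ts (Suc i)) \<omega> - X (ts i) \<omega>)) \<in> borel_measurable M"
      by (intro borel_measurable_prod measurable_compose[OF incr_meas]) simp
    have "(\<Prod>i<n. F (X (ts (Suc i)) \<omega> - X (ts i) \<omega>)) = F (X (ts n) \<omega> - X (ts 0) \<omega>)" for \<omega>
    proof -
      have "(\<Prod>i<m. F (X (ts (Suc i)) \<omega> - X (ts i) \<omega>)) = F (X (ts m) \<omega> - X (ts 0) \<omega>)" for m
        by (induction m) (auto simp: F_def cis_mult algebra_simps inner_add_right inner_diff_right)
      then show ?thesis .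
    qed
    moreover have "ts n = t" "ts 0 = 0"
      using n by (auto simp: ts_def)
    ultimately show "AE \<omega> in M. F (X t \<omega>) = (\<Prod>i<n. F (X (ts (Suc i)) \<omega> - X (ts i) \<omega>))"
      using X0 by auto
  qed
  also have "\<dots> = (\<Prod>i<n. \<integral>\<omega>. F (X (ts (Suc i)) \<omega> - X (ts i) \<omega>) \<partial>M)"
    using indepF integrable by (intro indep_vars_lebesgue_integral) auto
  also have "\<dots> = (\<Prod>i<n. \<integral>\<omega>. F (X (t / n) \<omega>) \<partial>M)"
  proof (rule prod.cong)
    fix i assume "i \<in> {..<n}"
    have "0 \<le> t / n"
      using t by simp
    have "(\<integral>\<omega>. F (X (ts (Suc i)) \<omega> - X (ts i) \<omega>) \<partial>M)
        = (\<integral>y. F y \<partial>distr M (count_space UNIV) (\<lambda>\<omega>. X (ts (Suc i)) \<omega> - X (ts i) \<omega>))"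
      by (rule integral_distr[symmetric]) (use incr_meas in auto)
    also have "\<dots> = (\<integral>y. F y \<partial>distr M (count_space UNIV) (X (t / n)))"
      using stationary[OF ts_nonneg \<open>0 \<le> t / n\<close>] by (simp add: ts_Suc)
    also have "\<dots> = (\<integral>\<omega>. F (X (t / n) \<omega>) \<partial>M)"
      by (rule integral_distr) (use X_meas[OF \<open>0 \<le> t / n\<close>] in auto)
    finally show "(\<integral>\<omega>. F (X (ts (Suc i)) \<omega> - X (ts i) \<omega>) \<partial>M) = (\<integral>\<omega>. F (X (t / n) \<omega>) \<partial>M)" .
  qed simp
  finally show ?thesis
    by (simp add: F_def)
qed

lemma random_walk_cf_derivative:
  fixes X :: "real \<Rightarrow> 'w \<Rightarrow> int ^ 'd"
  assumes walk: "random_walk c (pmf P) M X" and P: "symmetric_pmf P"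
  shows "((\<lambda>t. ((\<integral>\<omega>. cis (\<xi> \<bullet> real_vec (X t \<omega>)) \<partial>M) - 1) / of_real t) \<longlongrightarrow> - of_real (c * symb P \<xi>)) (at_right 0)"
proof -
  define F :: "int ^ 'd \<Rightarrow> complex" where "F = (\<lambda>y. cis (\<xi> \<bullet> real_vec y))"
  have "bounded (range F)"
    by (rule boundedI[where B = 1]) (auto simp: F_def)
  then have "uniform_limit UNIV
          (\<lambda>t x. ((\<integral>\<omega>. F (x + X t \<omega>) \<partial>M) - F x) / of_real t)
          (\<lambda>x. of_real c * rw_generator (pmf P) F x) (at_right 0)"
    using walk unfolding random_walk_def by blast
  from tendsto_uniform_limitI[OF this, of 0]
  have "((\<lambda>t. ((\<integral>\<omega>. F (X t \<omega>) \<partial>M) - 1) / of_real t) \<longlongrightarrow> of_real c * rw_generator (pmf P) F 0) (at_right 0)"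
    by (simp add: F_def)
  moreover have "rw_generator (pmf P) F 0 = - of_real (symb P \<xi>)"
    by (subst rw_generator_expectation[where C = 1]) (auto simp: F_def expectation_cis[OF P])
  ultimately show ?thesis
    by (simp add: F_def)
qed

text \<open>
  The derivative at time \<open>0\<close> shows that the characteristic function at time \<open>t / n\<close> differs from the
  exponential by \<open>o (1 / n)\<close>. Both have modulus at most \<open>1\<close>, so the \<open>n\<close>-th powers differ by
  \<open>o 1\<close>, while neither \<open>n\<close>-th power depends on \<open>n\<close>.
\<close>

theorem random_walk_cf:
  fixes X :: "real \<Rightarrow> 'w \<Rightarrow> int ^ 'd"
  assumes walk: "random_walk c (pmf P) M X" and P: "symmetric_pmf P" and c: "0 \<le> c" and t: "0 < t"
  shows "(\<integral>\<omega>. cis (\<xi> \<bullet> real_vec (X t \<omega>)) \<partial>M) = of_real (exp (- c * t * symb P \<xi>))"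
proof -
  interpret prob_space M
    using walk by (simp add: random_walk_def)
  define \<phi> where "\<phi> = (\<lambda>t. \<integral>\<omega>. cis (\<xi> \<bullet> real_vec (X t \<omega>)) \<partial>M)"
  define e where "e = (\<lambda>t. complex_of_real (exp (- c * t * symb P \<xi>)))"
  have \<phi>_le: "norm (\<phi> s) \<le> 1" for s
    unfolding \<phi>_def using integral_norm_bound[of M "\<lambda>\<omega>. cis (\<xi> \<bullet> real_vec (X s \<omega>))"] by (simp add: prob_space)
  have e_le: "norm (e s) \<le> 1" if "0 \<le> s" for s
    using that c symb_nonneg[of P \<xi>] by (simp add: e_def)
  have d1: "((\<lambda>t. (\<phi> t - 1) / of_real t) \<longlongrightarrow> - of_real (c * symb P \<xi>)) (at_right 0)"
    unfolding \<phi>_def by (rule random_walk_cf_derivative[OF walk P])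
  have "((\<lambda>t. exp (- c * t * symb P \<xi>)) has_real_derivative - (c * symb P \<xi>)) (at 0)"
    by (auto intro!: derivative_eq_intros)
  then have "((\<lambda>t. (exp (- c * t * symb P \<xi>) - 1) / t) \<longlongrightarrow> - (c * symb P \<xi>)) (at 0)"
    by (simp add: has_field_derivative_iff)
  then have "((\<lambda>t. (exp (- c * t * symb P \<xi>) - 1) / t) \<longlongrightarrow> - (c * symb P \<xi>)) (at_right 0)"
    by (rule tendsto_within_subset) simp
  then have "((\<lambda>t. complex_of_real ((exp (- c * t * symb P \<xi>) - 1) / t)) \<longlongrightarrow> of_real (- (c * symb P \<xi>))) (at_right 0)"
    by (rule tendsto_of_real)
  then have d2: "((\<lambda>t. (e t - 1) / of_real t) \<longlongrightarrow> - of_real (c * symb P \<xi>)) (at_right 0)"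
    by (simp add: e_def)
  have lim0: "((\<lambda>t. (\<phi> t - e t) / of_real t) \<longlongrightarrow> 0) (at_right 0)"
    using tendsto_diff[OF d1 d2] by (simp add: diff_divide_distrib)
  have "filterlim (\<lambda>n. t / real n) (at_right 0) sequentially"
    unfolding filterlim_at
    using t by (auto intro!: always_eventually tendsto_divide_0[OF tendsto_const] 
        filterlim_at_top_imp_at_infinity filterlim_real_sequentially eventually_sequentiallyI[of 1])
  from filterlim_compose[OF lim0 this]
  have lim: "(\<lambda>n. t * norm ((\<phi> (t / n) - e (t / n)) / of_real (t / n))) \<longlonglongrightarrow> 0"
    by (auto intro: tendsto_mult_right_zero tendsto_norm_zero)
  have bound: "norm (\<phi> t - e t) \<le> t * norm ((\<phi> (t / n) - e (t / n)) / of_real (t / n))" if n: "0 < n" for n :: nat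
  proof -
    have "e t = e (t / n) ^ n"
      unfolding e_def of_real_power[symmetric] exp_of_nat_mult[symmetric] using n by simp
    moreover have "\<phi> t = \<phi> (t / n) ^ n"
      unfolding \<phi>_def using t n by (intro random_walk_cf_power[OF walk]) auto
    ultimately have "norm (\<phi> t - e t) \<le> n * norm (\<phi> (t / n) - e (t / n))"
      using norm_power_diff[OF \<phi>_le e_le, of "t / n" "t / n" n] t n by simp
    also have "\<dots> = t * norm ((\<phi> (t / n) - e (t / n)) / of_real (t / n))"
      using t n by (simp add: norm_divide norm_mult mult.commute)
    finally show ?thesis .
  qed
  have "norm (\<phi> t - e t) \<le> 0"
    by (rule tendsto_lowerbound[OF lim]) (use bound in \<open>auto intro!: eventually_sequentiallyI[of 1]\<close>)
  then show ?thesis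
    by (simp add: \<phi>_def e_def)
qed

section \<open>Behaviour of the symbol near the origin\<close>

text \<open>
  Convergence in distribution is tested on cosines; the characteristic function of
  \<open>X t / t powr (1 / \<alpha>)\<close> is explicit by the previous result.
\<close>

lemma symb_scaling_limit_cf:
  fixes X :: "real \<Rightarrow> 'w \<Rightarrow> int ^ 'd"
  assumes walk: "random_walk c (pmf P) M X" and P: "symmetric_pmf P" and c: "0 \<le> c"
    and lim: "converges_in_distribution M (\<lambda>t \<omega>. real_vec (X t \<omega>) /\<^sub>R (t powr (1 / \<alpha>))) \<mu>"
  shows "((\<lambda>t. exp (- c * t * symb P ((t powr (- (1 / \<alpha>))) *\<^sub>R \<xi>))) \<longlongrightarrow> (\<integral>x. cos (\<xi> \<bullet> x) \<partial>\<mu>)) at_top"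
proof -
  interpret prob_space M
    using walk by (simp add: random_walk_def)
  have X_meas: "X s \<in> M \<rightarrow>\<^sub>M count_space UNIV" if "0 \<le> s" for s
    using walk that by (simp add: random_walk_def)
  have "continuous_on UNIV (\<lambda>x. cos (\<xi> \<bullet> x))" "bounded (range (\<lambda>x. cos (\<xi> \<bullet> x)))"
    by (auto intro!: continuous_intros boundedI[where B = 1])
  then have "((\<lambda>t. \<integral>\<omega>. cos (\<xi> \<bullet> (real_vec (X t \<omega>) /\<^sub>R (t powr (1 / \<alpha>)))) \<partial>M) \<longlongrightarrow> (\<integral>x. cos (\<xi> \<bullet> x) \<partial>\<mu>)) at_top"
    using lim unfolding converges_in_distribution_def by blast
  moreover have "\<forall>\<^sub>F t in at_top. (\<integral>\<omega>. cos (\<xi> \<bullet> (real_vec (X t \<omega>) /\<^sub>R (t powr (1 / \<alpha>)))) \<partial>M)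
      = exp (- c * t * symb P ((t powr (- (1 / \<alpha>))) *\<^sub>R \<xi>))"
    using eventually_gt_at_top[of 0]
  proof eventually_elim
    case (elim t)
    define \<eta> where "\<eta> = (t powr (- (1 / \<alpha>))) *\<^sub>R \<xi>"
    have "(\<integral>\<omega>. cos (\<xi> \<bullet> (real_vec (X t \<omega>) /\<^sub>R (t powr (1 / \<alpha>)))) \<partial>M) = (\<integral>\<omega>. Re (cis (\<eta> \<bullet> real_vec (X t \<omega>))) \<partial>M)"
      by (simp add: \<eta>_def powr_minus)
    also have "\<dots> = Re (\<integral>\<omega>. cis (\<eta> \<bullet> real_vec (X t \<omega>)) \<partial>M)"
    proof (rule integral_Re, rule integrable_const_bound[where B = 1])
      show "(\<lambda>\<omega>. cis (\<eta> \<bullet> real_vec (X t \<omega>))) \<in> borel_measurable M"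
        by (rule measurable_compose[OF X_meas]) (use elim in auto)
    qed simp
    also have "\<dots> = exp (- c * t * symb P \<eta>)"
      by (subst random_walk_cf[OF walk P c elim]) simp
    finally show ?case
      by (simp add: \<eta>_def)
  qed
  ultimately show ?thesis
    by (rule Lim_transform_eventually)
qed

text \<open>
  Along each ray the symbol is asymptotic to a positive multiple of the power \<open>\<alpha>\<close>. The limit \<open>h\<close> of
  the characteristic functions inherits \<open>h (s powr (1 / \<alpha>) *\<^sub>R \<xi>) = h \<xi> powr s\<close> from the time scaling;
  only integer \<open>s\<close> is needed. By continuity at the origin, \<open>h\<close> has no zeros, and \<open>h \<xi> = 1\<close> would force
  \<open>\<xi> \<bullet> x = 0\<close> almost surely. Hence \<open>- ln (h \<xi>)\<close> is finite and positive.
\<close>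

lemma symb_ray_asymptotics:
  fixes P :: "(int ^ 'd) pmf"
  assumes c: "0 < c" and \<alpha>: "0 < \<alpha>"
    and \<mu>: "prob_space \<mu>" "sets \<mu> = sets borel"
    and nondeg: "nondegenerate_law \<mu>"
    and lim: "\<And>\<xi>. ((\<lambda>t. exp (- c * t * symb P ((t powr (- (1 / \<alpha>))) *\<^sub>R \<xi>))) \<longlongrightarrow> (\<integral>x. cos (\<xi> \<bullet> x) \<partial>\<mu>)) at_top"
    and \<xi>: "\<xi> \<noteq> 0"
  shows "\<exists>l>0. ((\<lambda>r. symb P (r *\<^sub>R \<xi>) / r powr \<alpha>) \<longlongrightarrow> l) (at_right 0)"
proof -
  interpret prob_space \<mu> by fact
  define h where "h = (\<lambda>\<xi>. \<integral>x. cos (\<xi> \<bullet> x) \<partial>\<mu>)"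
  have [measurable]: "(\<lambda>x. cos (\<eta> \<bullet> x)) \<in> borel_measurable \<mu>" for \<eta>
    unfolding measurable_cong_sets[OF \<mu>(2) refl] by measurable
  have int: "integrable \<mu> (\<lambda>x. cos (\<eta> \<bullet> x))" for \<eta>
    by (rule integrable_const_bound[where B = 1]) auto
  have h_nonneg: "0 \<le> h \<eta>" for \<eta>
    unfolding h_def by (rule tendsto_lowerbound[OF lim]) auto
  have h_le: "h \<eta> \<le> 1" for \<eta>
    unfolding h_def using integral_mono[OF int integrable_const[of 1], of \<eta>] by (simp add: prob_space)
  define q where "q = (\<lambda>n. real (Suc n) powr (- (1 / \<alpha>)))"
  have q_pos: "0 < q n" for n
    by (simp add: q_def)
  have q_lim: "q \<longlonglongrightarrow> 0"
    unfolding q_def using \<alpha>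
    by (intro tendsto_neg_powr filterlim_compose[OF filterlim_real_sequentially] filterlim_Suc) auto
  have scale: "h \<xi> = h (q n *\<^sub>R \<xi>) ^ Suc n" for n
  proof -
    define s where "s = real (Suc n)"
    have s: "0 < s" by (simp add: s_def)
    have "((\<lambda>t. exp (- c * t * symb P ((t powr (- (1 / \<alpha>))) *\<^sub>R (q n *\<^sub>R \<xi>))) ^ Suc n) \<longlongrightarrow> h (q n *\<^sub>R \<xi>) ^ Suc n) at_top"
      unfolding h_def by (intro tendsto_power lim)
    moreover have "((\<lambda>t. exp (- c * (s * t) * symb P (((s * t) powr (- (1 / \<alpha>))) *\<^sub>R \<xi>))) \<longlongrightarrow> h \<xi>) at_top"
      unfolding h_def
      by (rule filterlim_compose[OF lim]) (intro filterlim_tendsto_pos_mult_at_top[OF tendsto_const s] filterlim_ident)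
    moreover have "\<forall>\<^sub>F t in at_top. exp (- c * (s * t) * symb P (((s * t) powr (- (1 / \<alpha>))) *\<^sub>R \<xi>))
        = exp (- c * t * symb P ((t powr (- (1 / \<alpha>))) *\<^sub>R (q n *\<^sub>R \<xi>))) ^ Suc n"
      using eventually_gt_at_top[of 0]
    proof eventually_elim
      case (elim t)
      have "(s * t) powr (- (1 / \<alpha>)) = t powr (- (1 / \<alpha>)) * q n"
        using elim s by (simp add: powr_mult q_def s_def)
      then show ?case
        unfolding exp_of_nat_mult[symmetric] by (simp add: s_def algebra_simps)
    qed
    ultimately show ?thesis
      by (intro tendsto_unique[OF _ Lim_transform_eventually]) auto
  qed
  have h_pos: "0 < h \<xi>"
  proof (rule ccontr)
    assume "\<not> 0 < h \<xi>"
    then have "h (q n *\<^sub>R \<xi>) = 0" for n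
      using h_nonneg[of \<xi>] scale[of n] by auto
    moreover have "(\<lambda>n. h (q n *\<^sub>R \<xi>)) \<longlonglongrightarrow> (\<integral>x. 1 \<partial>\<mu>)"
      unfolding h_def
    proof (rule integral_dominated_convergence[where w = "\<lambda>_. 1"])
      show "AE x in \<mu>. (\<lambda>n. cos ((q n *\<^sub>R \<xi>) \<bullet> x)) \<longlonglongrightarrow> 1"
      proof (rule AE_I2)
        fix x
        have "(\<lambda>n. cos (q n * (\<xi> \<bullet> x))) \<longlonglongrightarrow> cos (0 * (\<xi> \<bullet> x))"
          by (intro tendsto_intros q_lim)
        then show "(\<lambda>n. cos ((q n *\<^sub>R \<xi>) \<bullet> x)) \<longlonglongrightarrow> 1" by simp
      qed
    qed (auto simp del: inner_scaleR_left)
    ultimately show False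
      by (simp add: prob_space LIMSEQ_const_iff)
  qed
  have h_lt: "h \<xi> < 1"
  proof (rule ccontr)
    assume "\<not> h \<xi> < 1"
    then have "h \<xi> = 1"
      using h_le[of \<xi>] by simp
    have one: "h (q n *\<^sub>R \<xi>) = 1" for n
      using scale[of n] \<open>h \<xi> = 1\<close> h_nonneg[of "q n *\<^sub>R \<xi>"]
        power_inject_base[of "h (q n *\<^sub>R \<xi>)" n 1] by simp
    \<comment> \<open>A cosine with mean \<open>1\<close> equals \<open>1\<close> almost surely; since \<open>q n\<close> tends to \<open>0\<close>, small frequencies
      exclude nonzero multiples of \<open>2 * pi\<close>.\<close>
    have "AE x in \<mu>. 1 - cos ((q n *\<^sub>R \<xi>) \<bullet> x) = 0" for n
    proof (subst integral_nonneg_eq_0_iff_AE[symmetric])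
      show "(\<integral>x. 1 - cos ((q n *\<^sub>R \<xi>) \<bullet> x) \<partial>\<mu>) = 0"
        using one[of n] unfolding h_def
        by (subst Bochner_Integration.integral_diff) (use int in \<open>auto simp: prob_space simp del: inner_scaleR_left\<close>)
      show "integrable \<mu> (\<lambda>x. 1 - cos ((q n *\<^sub>R \<xi>) \<bullet> x))"
        by (intro Bochner_Integration.integrable_diff int) auto
    qed auto
    then have "AE x in \<mu>. \<forall>n. 1 - cos ((q n *\<^sub>R \<xi>) \<bullet> x) = 0"
      unfolding AE_all_countable by blast
    then have "AE x in \<mu>. \<xi> \<bullet> x = 0"
    proof eventually_elim
      case (elim x)
      have "(\<lambda>n. q n * \<bar>\<xi> \<bullet> x\<bar>) \<longlonglongrightarrow> 0 * \<bar>\<xi> \<bullet> x\<bar>"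
        by (intro tendsto_intros q_lim)
      then have "\<forall>\<^sub>F n in sequentially. q n * \<bar>\<xi> \<bullet> x\<bar> < 1"
        by (auto dest: order_tendstoD(2)[of _ _ _ 1])
      then obtain n where "q n * \<bar>\<xi> \<bullet> x\<bar> < 1"
        by (auto simp: eventually_sequentially)
      then have less: "\<bar>q n * (\<xi> \<bullet> x)\<bar> < 1"
        using q_pos[of n] by (simp add: abs_mult)
      have "cos \<bar>q n * (\<xi> \<bullet> x)\<bar> = 1"
        using elim by simp
      moreover have "cos \<bar>q n * (\<xi> \<bullet> x)\<bar> < cos 0" if "0 < \<bar>q n * (\<xi> \<bullet> x)\<bar>"
        using that less pi_gt3 by (intro cos_monotone_0_pi) auto
      ultimately have "q n * (\<xi> \<bullet> x) = 0"
        by force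
      then show ?case
        using q_pos[of n] by simp
    qed
    then show False
      using nondeg \<xi> unfolding nondegenerate_law_def by blast
  qed
  define l where "l = - ln (h \<xi>) / c"
  have "0 < l"
    using h_pos h_lt c by (simp add: l_def divide_neg_pos)
  moreover have "((\<lambda>r. symb P (r *\<^sub>R \<xi>) / r powr \<alpha>) \<longlongrightarrow> l) (at_right 0)"
  proof -
    have "((\<lambda>t. - ln (exp (- c * t * symb P ((t powr (- (1 / \<alpha>))) *\<^sub>R \<xi>))) / c) \<longlongrightarrow> l) at_top"
      unfolding l_def using h_pos lim[of \<xi>] c by (intro tendsto_intros) (auto simp: h_def)
    then have lim_t: "((\<lambda>t. t * symb P ((t powr (- (1 / \<alpha>))) *\<^sub>R \<xi>)) \<longlongrightarrow> l) at_top"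
      using c by simp
    have "filterlim (\<lambda>r. r powr (- \<alpha>)) at_top (at_right (0::real))"
      using \<alpha> by real_asymp
    from filterlim_compose[OF lim_t this]
    have "((\<lambda>r. (r powr (- \<alpha>)) * symb P (((r powr (- \<alpha>)) powr (- (1 / \<alpha>))) *\<^sub>R \<xi>)) \<longlongrightarrow> l) (at_right 0)" .
    moreover have "\<forall>\<^sub>F r in at_right 0. (r powr (- \<alpha>)) * symb P (((r powr (- \<alpha>)) powr (- (1 / \<alpha>))) *\<^sub>R \<xi>)
        = symb P (r *\<^sub>R \<xi>) / r powr \<alpha>"
      using eventually_at_right_less[of 0]
    proof eventually_elim
      case (elim r)
      have "(r powr (- \<alpha>)) powr (- (1 / \<alpha>)) = r"
        using elim \<alpha> by (simp add: powr_powr)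
      then show ?case
        by (simp add: powr_minus field_simps)
    qed
    ultimately show ?thesis
      by (rule Lim_transform_eventually)
  qed
  ultimately show ?thesis
    by blast
qed

lemma symb_sum_le: "finite I \<Longrightarrow> symb P (\<Sum>i\<in>I. v i) \<le> 2 ^ card I * (\<Sum>i\<in>I. symb P (v i))"
proof (induction I rule: finite_induct)
  case (insert i I)
  have "symb P (v i + (\<Sum>i\<in>I. v i)) \<le> 2 * symb P (v i) + 2 * (2 ^ card I * (\<Sum>i\<in>I. symb P (v i)))"
    using symb_add_le[of P "v i" "\<Sum>i\<in>I. v i"] insert.IH by linarith
  also have "\<dots> \<le> 2 * 2 ^ card I * symb P (v i) + 2 * (2 ^ card I * (\<Sum>i\<in>I. symb P (v i)))"
    using mult_right_mono[of 1 "2 ^ card I" "symb P (v i)"] symb_nonneg[of P "v i"] by simp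
  finally show ?case
    using insert by (simp add: algebra_simps)
qed simp

text \<open>
  The upper bound on the coordinate axes extends to all directions because the symbol is
  subadditive up to constants.
\<close>

lemma symb_upper:
  fixes P :: "(int ^ 'd) pmf"
  assumes \<alpha>: "0 < \<alpha>"
    and ray: "\<And>\<xi>. \<xi> \<noteq> 0 \<Longrightarrow> \<exists>l>0. ((\<lambda>r. symb P (r *\<^sub>R \<xi>) / r powr \<alpha>) \<longlongrightarrow> l) (at_right 0)"
  obtains C \<delta> where "0 \<le> C" "0 < \<delta>" "\<And>\<eta>. norm \<eta> < \<delta> \<Longrightarrow> symb P \<eta> \<le> C * norm \<eta> powr \<alpha>"
proof -
  have "\<exists>C d. 0 \<le> C \<and> 0 < d \<and> (\<forall>r. \<bar>r\<bar> < d \<longrightarrow> symb P (r *\<^sub>R axis i 1) \<le> C * \<bar>r\<bar> powr \<alpha>)" for i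
  proof -
    have "axis i (1::real) \<noteq> 0"
      by (simp add: axis_eq_0_iff)
    then obtain l where l: "0 < l" "((\<lambda>r. symb P (r *\<^sub>R axis i 1) / r powr \<alpha>) \<longlongrightarrow> l) (at_right 0)"
      using ray by blast
    have "\<forall>\<^sub>F r in at_right 0. symb P (r *\<^sub>R axis i 1) / r powr \<alpha> < l + 1"
      using l by (intro order_tendstoD) auto
    then obtain d where d: "0 < d" "\<And>r. 0 < r \<Longrightarrow> r < d \<Longrightarrow> symb P (r *\<^sub>R axis i 1) / r powr \<alpha> < l + 1"
      by (auto simp: eventually_at_right_field)
    have pos: "symb P (r *\<^sub>R axis i 1) \<le> (l + 1) * r powr \<alpha>" if "0 < r" "r < d" for r
      using d(2)[OF that] that by (simp add: field_simps)
    have "symb P (r *\<^sub>R axis i 1) \<le> (l + 1) * \<bar>r\<bar> powr \<alpha>" if "\<bar>r\<bar> < d" for r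
    proof -
      consider "r = 0" | "0 < r" | "0 < - r"
        by linarith
      then show ?thesis
      proof cases
        case 3
        then show ?thesis
          using pos[of "- r"] that symb_minus[of P "r *\<^sub>R axis i 1"] by simp
      qed (use pos[of r] that in auto)
    qed
    then show ?thesis
      using d(1) l(1) by (intro exI[of _ "l + 1"] exI[of _ d]) auto
  qed
  then obtain C d where Cd: "\<And>i. 0 \<le> C i" "\<And>i. 0 < d i"
      "\<And>i r. \<bar>r\<bar> < d i \<Longrightarrow> symb P (r *\<^sub>R axis i 1) \<le> C i * \<bar>r\<bar> powr \<alpha>"
    by metis
  define \<delta> where "\<delta> = Min (range d)"
  show ?thesis
  proof (rule that)
    show "0 \<le> 2 ^ CARD('d) * (\<Sum>i\<in>UNIV. C i)"
      using Cd(1) by (simp add: sum_nonneg)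
    show "0 < \<delta>"
      using Cd(2) by (auto simp: \<delta>_def)
    fix \<eta> :: "real ^ 'd" assume \<eta>: "norm \<eta> < \<delta>"
    have "symb P \<eta> = symb P (\<Sum>i\<in>UNIV. (\<eta> $ i) *\<^sub>R axis i 1)"
      using basis_expansion[of \<eta>] by (simp add: scalar_mult_eq_scaleR)
    also have "\<dots> \<le> 2 ^ CARD('d) * (\<Sum>i\<in>UNIV. symb P ((\<eta> $ i) *\<^sub>R axis i 1))"
      by (rule symb_sum_le) simp
    also have "\<dots> \<le> 2 ^ CARD('d) * (\<Sum>i\<in>UNIV. C i * norm \<eta> powr \<alpha>)"
    proof (intro mult_left_mono sum_mono)
      fix i
      have le: "\<bar>\<eta> $ i\<bar> \<le> norm \<eta>"
        by (rule component_le_norm_cart)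
      moreover have "\<delta> \<le> d i"
        by (simp add: \<delta>_def)
      ultimately have "symb P ((\<eta> $ i) *\<^sub>R axis i 1) \<le> C i * \<bar>\<eta> $ i\<bar> powr \<alpha>"
        using \<eta> by (intro Cd(3)) simp
      also have "\<dots> \<le> C i * norm \<eta> powr \<alpha>"
        using Cd(1) le \<alpha> by (intro mult_left_mono powr_mono2) auto
      finally show "symb P ((\<eta> $ i) *\<^sub>R axis i 1) \<le> C i * norm \<eta> powr \<alpha>" .
    qed simp
    also have "\<dots> = 2 ^ CARD('d) * (\<Sum>i\<in>UNIV. C i) * norm \<eta> powr \<alpha>"
      by (simp add: sum_distrib_right)
    finally show "symb P \<eta> \<le> 2 ^ CARD('d) * (\<Sum>i\<in>UNIV. C i) * norm \<eta> powr \<alpha>" .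
  qed
qed

text \<open>
  The positive limits along the individual rays give a uniform lower bound: were it to fail along
  a sequence, a subsequence of the directions would converge to some \<open>\<zeta>\<close>, and subadditivity together
  with the upper bound would make the limit along the ray through \<open>\<zeta>\<close> vanish.
\<close>

lemma symb_lower_near_0:
  fixes P :: "(int ^ 'd) pmf"
  assumes \<alpha>: "0 < \<alpha>"
    and ray: "\<And>\<xi>. \<xi> \<noteq> 0 \<Longrightarrow> \<exists>l>0. ((\<lambda>r. symb P (r *\<^sub>R \<xi>) / r powr \<alpha>) \<longlongrightarrow> l) (at_right 0)"
  obtains c \<delta> where "0 < c" "0 < \<delta>" "\<And>\<eta>. norm \<eta> < \<delta> \<Longrightarrow> c * norm \<eta> powr \<alpha> \<le> symb P \<eta>"
proof (rule ccontr)
  assume neg: "\<not> thesis"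
  have "\<exists>\<eta>. norm \<eta> < 1 / Suc n \<and> symb P \<eta> < 1 / Suc n * norm \<eta> powr \<alpha>" for n
  proof (rule ccontr)
    assume "\<nexists>\<eta>. norm \<eta> < 1 / Suc n \<and> symb P \<eta> < 1 / Suc n * norm \<eta> powr \<alpha>"
    then have "1 / Suc n * norm \<eta> powr \<alpha> \<le> symb P \<eta>" if "norm \<eta> < 1 / Suc n" for \<eta>
      using that by (meson not_less)
    then show False
      using neg that[of "1 / Suc n" "1 / Suc n"] by auto
  qed
  then obtain \<theta> where \<theta>: "\<And>n. norm (\<theta> n) < 1 / Suc n" "\<And>n. symb P (\<theta> n) < 1 / Suc n * norm (\<theta> n) powr \<alpha>"
    by metis
  have nz: "\<theta> n \<noteq> 0" for n
    using \<theta>(2)[of n] by auto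
  define \<xi> where "\<xi> = (\<lambda>n. \<theta> n /\<^sub>R norm (\<theta> n))"
  have "\<xi> n \<in> sphere 0 1" for n
    using nz by (simp add: \<xi>_def)
  then obtain \<zeta> r where \<zeta>: "\<zeta> \<in> sphere 0 1" "strict_mono r" "(\<xi> \<circ> r) \<longlonglongrightarrow> \<zeta>"
    using compact_sphere[of "0 :: real ^ 'd" 1] unfolding compact_def by metis
  then have "\<zeta> \<noteq> 0"
    by auto
  then obtain l where l: "0 < l" "((\<lambda>r. symb P (r *\<^sub>R \<zeta>) / r powr \<alpha>) \<longlongrightarrow> l) (at_right 0)"
    using ray by blast
  obtain C \<delta> where C: "0 \<le> C" "0 < \<delta>" "\<And>\<eta>. norm \<eta> < \<delta> \<Longrightarrow> symb P \<eta> \<le> C * norm \<eta> powr \<alpha>"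
    using symb_upper[OF \<alpha> ray] by metis
  define \<rho> where "\<rho> = (\<lambda>n. norm (\<theta> (r n)))"
  have \<rho>_pos: "0 < \<rho> n" for n
    using nz by (simp add: \<rho>_def)
  have "(\<lambda>n. norm (\<theta> n)) \<longlonglongrightarrow> 0"
    by (rule real_tendsto_sandwich[OF _ _ tendsto_const LIMSEQ_inverse_real_of_nat])
       (use \<theta>(1) in \<open>auto intro!: always_eventually less_imp_le simp: inverse_eq_divide\<close>)
  from LIMSEQ_subseq_LIMSEQ[OF this \<zeta>(2)]
  have \<rho>_lim: "\<rho> \<longlonglongrightarrow> 0"
    by (simp add: \<rho>_def o_def)
  then have \<rho>_right: "filterlim \<rho> (at_right 0) sequentially"
    using \<rho>_pos by (auto simp: filterlim_at less_imp_neq[symmetric] intro!: always_eventually)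
  have dist_lim: "(\<lambda>n. \<zeta> - \<xi> (r n)) \<longlonglongrightarrow> 0"
    using tendsto_diff[OF tendsto_const \<zeta>(3), of \<zeta>] by (simp add: o_def)
  have "(\<lambda>n. symb P (\<rho> n *\<^sub>R \<zeta>) / \<rho> n powr \<alpha>) \<longlonglongrightarrow> l"
    by (rule filterlim_compose[OF l(2) \<rho>_right])
  moreover have "(\<lambda>n. 2 * (1 / Suc (r n)) + 2 * C * norm (\<zeta> - \<xi> (r n)) powr \<alpha>) \<longlonglongrightarrow> 2 * 0 + 2 * C * 0"
  proof (intro tendsto_intros)
    show "(\<lambda>n. 1 / real (Suc (r n))) \<longlonglongrightarrow> 0"
      using LIMSEQ_subseq_LIMSEQ[OF LIMSEQ_inverse_real_of_nat \<zeta>(2)] by (simp add: o_def inverse_eq_divide)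
    show "(\<lambda>n. norm (\<zeta> - \<xi> (r n)) powr \<alpha>) \<longlonglongrightarrow> 0"
      using tendsto_zero_powrI[OF tendsto_norm_zero[OF dist_lim] tendsto_const] \<alpha> by simp
  qed
  moreover have "\<forall>\<^sub>F n in sequentially. symb P (\<rho> n *\<^sub>R \<zeta>) / \<rho> n powr \<alpha>
      \<le> 2 * (1 / Suc (r n)) + 2 * C * norm (\<zeta> - \<xi> (r n)) powr \<alpha>"
  proof -
    have "(\<lambda>n. \<rho> n * norm (\<zeta> - \<xi> (r n))) \<longlonglongrightarrow> 0 * 0"
      using tendsto_norm_zero[OF dist_lim] by (intro tendsto_intros \<rho>_lim) auto
    then have "\<forall>\<^sub>F n in sequentially. \<rho> n * norm (\<zeta> - \<xi> (r n)) < \<delta>"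
      using C(2) by (auto dest: order_tendstoD(2))
    then show ?thesis
    proof eventually_elim
      case (elim n)
      have \<theta>_eq: "\<theta> (r n) = \<rho> n *\<^sub>R \<xi> (r n)"
        using nz by (simp add: \<rho>_def \<xi>_def)
      have nrm: "norm (\<rho> n *\<^sub>R (\<zeta> - \<xi> (r n))) = \<rho> n * norm (\<zeta> - \<xi> (r n))"
        using \<rho>_pos[of n] by simp
      have "symb P (\<rho> n *\<^sub>R \<zeta>) = symb P (\<theta> (r n) + \<rho> n *\<^sub>R (\<zeta> - \<xi> (r n)))"
        by (simp add: \<theta>_eq algebra_simps)
      also have "\<dots> \<le> 2 * symb P (\<theta> (r n)) + 2 * symb P (\<rho> n *\<^sub>R (\<zeta> - \<xi> (r n)))"
        by (rule symb_add_le)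
      also have "\<dots> \<le> 2 * (1 / Suc (r n) * \<rho> n powr \<alpha>) + 2 * (C * (\<rho> n * norm (\<zeta> - \<xi> (r n))) powr \<alpha>)"
        using \<theta>(2)[of "r n"] C(3)[of "\<rho> n *\<^sub>R (\<zeta> - \<xi> (r n))"] elim nrm by (simp add: \<rho>_def)
      also have "\<dots> = (2 * (1 / Suc (r n)) + 2 * C * norm (\<zeta> - \<xi> (r n)) powr \<alpha>) * \<rho> n powr \<alpha>"
        using \<rho>_pos[of n] by (simp add: powr_mult algebra_simps)
      finally show ?case
        using \<rho>_pos[of n] by (simp add: pos_divide_le_eq)
    qed
  qed
  ultimately have "l \<le> 2 * 0 + 2 * C * 0"
    by (intro tendsto_le[OF sequentially_bot]) auto
  then show False
    using l(1) by simp
qed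

text \<open>
  Away from the origin of the cube some coordinate is bounded away from \<open>0\<close>, and the
  nearest-neighbour steps in that direction already keep the symbol away from \<open>0\<close>.
\<close>

lemma symb_lower:
  fixes P :: "(int ^ 'd) pmf"
  assumes \<alpha>: "0 < \<alpha>" and nn: "\<And>i. 0 < pmf P (axis i 1)"
    and ray: "\<And>\<xi>. \<xi> \<noteq> 0 \<Longrightarrow> \<exists>l>0. ((\<lambda>r. symb P (r *\<^sub>R \<xi>) / r powr \<alpha>) \<longlongrightarrow> l) (at_right 0)"
  obtains c where "0 < c" "\<And>\<theta>. (\<And>i. \<bar>\<theta> $ i\<bar> \<le> pi) \<Longrightarrow> c * norm \<theta> powr \<alpha> \<le> symb P \<theta>"
proof -
  obtain c \<delta> where c: "0 < c" "0 < \<delta>" "\<And>\<eta>. norm \<eta> < \<delta> \<Longrightarrow> c * norm \<eta> powr \<alpha> \<le> symb P \<eta>"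
    using symb_lower_near_0[OF \<alpha> ray] by metis
  define p where "p = Min (range (\<lambda>i. pmf P (axis i 1)))"
  have p_pos: "0 < p"
    using nn by (auto simp: p_def)
  have p_le: "p \<le> pmf P (axis i 1)" for i
    by (simp add: p_def)
  define d where "d = real CARD('d)"
  have d_pos: "0 < d"
    by (simp add: d_def)
  define \<epsilon> where "\<epsilon> = min pi (\<delta> / d)"
  have \<epsilon>: "0 < \<epsilon>" "\<epsilon> \<le> pi" "\<epsilon> \<le> \<delta> / d"
    using c(2) d_pos by (auto simp: \<epsilon>_def)
  define m where "m = p * (1 - cos \<epsilon>)"
  have "cos \<epsilon> < cos 0"
    using \<epsilon> by (intro cos_monotone_0_pi) auto
  then have m_pos: "0 < m"
    using p_pos by (simp add: m_def)
  define c' where "c' = min c (m / (d * pi) powr \<alpha>)"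
  show ?thesis
  proof (rule that)
    show "0 < c'"
      using c(1) m_pos d_pos by (simp add: c'_def)
    fix \<theta> :: "real ^ 'd" assume cube: "\<And>i. \<bar>\<theta> $ i\<bar> \<le> pi"
    show "c' * norm \<theta> powr \<alpha> \<le> symb P \<theta>"
    proof (cases "norm \<theta> < \<delta>")
      case True
      have "c' * norm \<theta> powr \<alpha> \<le> c * norm \<theta> powr \<alpha>"
        by (intro mult_right_mono) (auto simp: c'_def)
      then show ?thesis
        using c(3)[OF True] by simp
    next
      case False
      have l1: "norm \<theta> \<le> (\<Sum>i\<in>UNIV. \<bar>\<theta> $ i\<bar>)"
        by (rule norm_le_l1_cart)
      obtain i where i: "\<epsilon> \<le> \<bar>\<theta> $ i\<bar>"
      proof (rule ccontr)
        assume "\<not> thesis"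
        then have "\<bar>\<theta> $ i\<bar> < \<epsilon>" for i
          using that[of i] by (meson not_le)
        then have "(\<Sum>i\<in>UNIV. \<bar>\<theta> $ i\<bar>) < (\<Sum>i\<in>(UNIV :: 'd set). \<epsilon>)"
          by (intro sum_strict_mono) auto
        also have "\<dots> \<le> \<delta>"
          using \<epsilon>(3) d_pos by (simp add: d_def field_simps)
        finally show False
          using False l1 by simp
      qed
      have "c' * norm \<theta> powr \<alpha> \<le> m / (d * pi) powr \<alpha> * (d * pi) powr \<alpha>"
      proof (intro mult_mono powr_mono2)
        have "(\<Sum>i\<in>UNIV. \<bar>\<theta> $ i\<bar>) \<le> (\<Sum>i\<in>(UNIV :: 'd set). pi)"
          by (intro sum_mono cube)
        then show "norm \<theta> \<le> d * pi"
          using l1 by (simp add: d_def)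
      qed (use m_pos \<alpha> in \<open>auto simp: c'_def\<close>)
      also have "\<dots> = m"
        using d_pos by simp
      also have "\<dots> \<le> pmf P (axis i 1) * (1 - cos (\<theta> $ i))"
        unfolding m_def
      proof (intro mult_mono p_le)
        have "cos \<bar>\<theta> $ i\<bar> \<le> cos \<epsilon>"
          using i \<epsilon> cube[of i] by (intro cos_monotone_0_pi_le) auto
        then show "1 - cos \<epsilon> \<le> 1 - cos (\<theta> $ i)"
          by simp
      qed auto
      also have "\<dots> \<le> symb P \<theta>"
        by (rule symb_lower_coordinate)
      finally show ?thesis .
    qed
  qed
qed

section \<open>Fourier analysis on the torus\<close>

text \<open>
  The normalised frequency circle, with the frequency \<open>0\<close> removed. Removing it makes the symbol
  positive at every point of the product space below, so that no exceptional null set is needed.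
\<close>

definition circle :: "real measure" where
  "circle = restrict_space lborel ({- (1 / 2)..1 / 2} - {0})"

lemma space_circle: "space circle = {- (1 / 2)..1 / 2} - {0}"
  by (simp add: circle_def space_restrict_space)

lemma prob_space_circle: "prob_space circle"
proof
  have "emeasure lborel ({- (1 / 2)..1 / 2} - {0::real}) = emeasure lborel {- (1 / 2)..1 / 2::real} - emeasure lborel {0::real}"
    by (intro emeasure_Diff) auto
  then show "emeasure circle (space circle) = 1"
    by (simp add: space_circle) (simp add: circle_def emeasure_restrict_space)
qed

lemma measurable_circle: "f \<in> borel_measurable borel \<Longrightarrow> f \<in> borel_measurable circle"
  unfolding circle_def by (rule measurable_restrict_space1) simp

lemma integral_circle_cis:
  "(\<integral>x. cis (2 * pi * of_int k * x) \<partial>circle) = (if k = 0 then 1 else 0)"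
proof -
  interpret prob_space circle
    by (rule prob_space_circle)
  show ?thesis
  proof (cases "k = 0")
    case True
    then show ?thesis
      using prob_space by simp
  next
    case False
    define w where "w = 2 * pi * real_of_int k"
    have w: "w \<noteq> 0"
      using False by (simp add: w_def)
    have [measurable]: "(\<lambda>x. cis (w * x)) \<in> borel_measurable borel"
      by (intro borel_measurable_continuous_onI continuous_intros)
    have "(\<integral>x. cis (w * x) \<partial>circle)
        = (\<integral>x. indicator ({- (1 / 2)..1 / 2} - {0}) x *\<^sub>R cis (w * x) \<partial>lborel)"
      unfolding circle_def by (rule integral_restrict_space) simp
    also have "\<dots> = (\<integral>x. indicator {- (1 / 2)..1 / 2} x *\<^sub>R cis (w * x) \<partial>lborel)"
    proof (rule integral_cong_AE)
      show "AE x in lborel. indicator ({- (1 / 2)..1 / 2} - {0}) x *\<^sub>R cis (w * x)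
          = indicator {- (1 / 2)..1 / 2} x *\<^sub>R cis (w * x)"
        using AE_lborel_singleton[of "0::real"] by eventually_elim (auto simp: indicator_def)
    qed measurable
    also have "\<dots> = cis (w * (1 / 2)) / (\<i> * of_real w) - cis (w * (- (1 / 2))) / (\<i> * of_real w)"
    proof (rule integral_FTC_Icc)
      fix x :: real
      have "((\<lambda>x. cis (w * x)) has_vector_derivative (w *\<^sub>R (\<i> * cis (w * x)))) (at x within {- (1 / 2)..1 / 2})"
        by (auto intro!: derivative_eq_intros simp: has_vector_derivative_def)
      then have "((\<lambda>x. cis (w * x) / (\<i> * of_real w)) has_vector_derivative (w *\<^sub>R (\<i> * cis (w * x))) / (\<i> * of_real w)) (at x within {- (1 / 2)..1 / 2})"
        by (rule has_vector_derivative_divide)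
      then show "((\<lambda>x. cis (w * x) / (\<i> * of_real w)) has_vector_derivative cis (w * x)) (at x within {- (1 / 2)..1 / 2})"
        using w by (simp add: scaleR_conv_of_real)
    qed (auto intro!: continuous_intros)
    also have "cis (w * (- (1 / 2))) = cis (w * (1 / 2))"
    proof -
      have "sin (pi * real_of_int k) = 0"
        by simp
      then show ?thesis
        by (simp add: w_def complex_eq_iff mult.commute)
    qed
    finally show ?thesis
      using False by (simp add: w_def)
  qed
qed

lemma integrable_circle_cis: "integrable circle (\<lambda>x. cis (w * x))"
proof -
  interpret prob_space circle
    by (rule prob_space_circle)
  show ?thesis
  proof (rule integrable_const_bound[where B = 1])
    show "(\<lambda>x. cis (w * x)) \<in> borel_measurable circle"
      by (intro measurable_circle borel_measurable_continuous_onI continuous_intros)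
  qed simp
qed

lemma nn_integral_circle_powr:
  assumes "0 \<le> \<beta>" "\<beta> < 1"
  shows "(\<integral>\<^sup>+x. ennreal (\<bar>x\<bar> powr (- \<beta>)) \<partial>circle) < \<infinity>"
proof -
  have "(\<lambda>x. x powr (- \<beta>)) integrable_on {0..1 / 2}"
    using assms by (intro integrable_on_powr_from_0) auto
  then obtain I where I: "((\<lambda>x. x powr (- \<beta>)) has_integral I) {0..1 / 2}"
    by blast
  define g where "g = (\<lambda>x::real. ennreal (indicator {0..1 / 2} x * x powr (- \<beta>)))"
  have g: "g \<in> borel_measurable borel"
    unfolding g_def by measurable
  have g_int: "(\<integral>\<^sup>+x. g x \<partial>lborel) = ennreal I"
    using nn_integral_has_integral_lebesgue[OF _ I] by (simp add: g_def)
  have g_int': "(\<integral>\<^sup>+x. g (- x) \<partial>lborel) = ennreal I"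
    using nn_integral_real_affine[OF g, of "- 1" 0] g_int by simp
  have "(\<integral>\<^sup>+x. ennreal (\<bar>x\<bar> powr (- \<beta>)) \<partial>circle)
      = (\<integral>\<^sup>+x. ennreal (\<bar>x\<bar> powr (- \<beta>)) * indicator ({- (1 / 2)..1 / 2} - {0}) x \<partial>lborel)"
    unfolding circle_def by (rule nn_integral_restrict_space) simp
  also have "\<dots> \<le> (\<integral>\<^sup>+x. g x + g (- x) \<partial>lborel)"
    by (intro nn_integral_mono) (auto simp: g_def indicator_def)
  also have "\<dots> = ennreal I + ennreal I"
    using g g_int g_int' by (subst nn_integral_add) auto
  also have "\<dots> < \<infinity>"
    by simp
  finally show ?thesis .
qed

text \<open>
  The frequency torus as a product of circles, so that product integrals factorise; \<open>angle\<close> below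
  converts a point to the corresponding vector in the cube \<open>[-pi, pi]\<^sup>d\<close>.
\<close>

definition torus :: "('d::finite \<Rightarrow> real) measure" where
  "torus = (\<Pi>\<^sub>M i\<in>UNIV. circle)"

definition angle :: "('d::finite \<Rightarrow> real) \<Rightarrow> real ^ 'd" where
  "angle u = (\<chi> i. 2 * pi * u i)"

lemma product_prob_space_circle: "product_prob_space (\<lambda>_. circle)"
  by (intro product_prob_spaceI prob_space_circle)

lemma prob_space_torus: "prob_space torus"
  unfolding torus_def by (intro prob_space_PiM prob_space_circle)

lemma space_torusD: "u \<in> space torus \<Longrightarrow> \<bar>u i\<bar> \<le> 1 / 2 \<and> u i \<noteq> 0"
  using PiE_mem[of u UNIV "\<lambda>_. space circle" i]
  by (auto simp: torus_def space_PiM space_circle)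

lemma angle_inner: "angle u \<bullet> real_vec z = (\<Sum>i\<in>UNIV. 2 * pi * of_int (z $ i) * u i)"
  by (simp add: angle_def real_vec_def inner_vec_def mult_ac)

lemma measurable_torus_component [measurable]: "(\<lambda>u. u i) \<in> borel_measurable torus"
proof -
  have id: "(\<lambda>x. x) \<in> borel_measurable circle"
    by (rule measurable_circle) simp
  have "(\<lambda>u. u i) \<in> torus \<rightarrow>\<^sub>M circle"
    unfolding torus_def by (rule measurable_component_singleton) simp
  then show ?thesis
    by (rule measurable_compose[OF _ id])
qed

lemma integrable_torus_bounded:
  fixes f :: "_ \<Rightarrow> 'b::{banach, second_countable_topology}"
  assumes "f \<in> borel_measurable torus" "\<And>u. norm (f u) \<le> C"
  shows "integrable torus f"
proof -
  interpret prob_space torus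
    by (rule prob_space_torus)
  show ?thesis
    by (rule integrable_const_bound[where B = C]) (use assms in auto)
qed

lemma integral_torus_cos:
  fixes z :: "int ^ 'd"
  shows "(\<integral>u. cos (angle u \<bullet> real_vec z) \<partial>torus) = (if z = 0 then 1 else 0)"
proof -
  interpret product_prob_space "\<lambda>_::'d. circle"
    by (rule product_prob_space_circle)
  have "(\<integral>u. cis (angle u \<bullet> real_vec z) \<partial>torus)
      = (\<integral>u. (\<Prod>i\<in>UNIV. cis (2 * pi * of_int (z $ i) * u i)) \<partial>torus)"
    unfolding angle_inner by (subst cis_sum) auto
  also have "\<dots> = (\<Prod>i\<in>UNIV. \<integral>x. cis (2 * pi * of_int (z $ i) * x) \<partial>circle)"
    unfolding torus_def by (rule product_integral_prod) (auto intro: integrable_circle_cis)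
  also have "\<dots> = (if z = 0 then 1 else 0)"
    by (auto simp: integral_circle_cis vec_eq_iff)
  finally have cis_eq: "(\<integral>u. cis (angle u \<bullet> real_vec z) \<partial>torus) = (if z = 0 then 1 else 0)" .
  have "(\<integral>u. Re (cis (angle u \<bullet> real_vec z)) \<partial>torus) = Re (if z = 0 then 1 else 0)"
    unfolding cis_eq[symmetric]
  proof (rule integral_Re, rule integrable_torus_bounded[where C = 1])
    have "cis \<in> borel_measurable borel"
      by (intro borel_measurable_continuous_onI continuous_intros)
    moreover have "(\<lambda>u. angle u \<bullet> real_vec z) \<in> borel_measurable torus"
      unfolding angle_inner by measurable
    ultimately show "(\<lambda>u. cis (angle u \<bullet> real_vec z)) \<in> borel_measurable torus"
      by (rule measurable_compose[rotated])
  qed simp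
  then show ?thesis
    by simp
qed

lemma measurable_torus_pmf_inner [measurable]:
  "(\<lambda>(u, z). angle u \<bullet> real_vec z) \<in> borel_measurable (torus \<Otimes>\<^sub>M measure_pmf P)"
proof -
  have [measurable]: "(\<lambda>p. fst p i) \<in> borel_measurable (torus \<Otimes>\<^sub>M measure_pmf P)" for i
    by (rule measurable_compose[OF measurable_fst measurable_torus_component])
  have [measurable]: "(\<lambda>p. real_of_int (snd p $ i)) \<in> borel_measurable (torus \<Otimes>\<^sub>M measure_pmf P)" for i
    by (rule measurable_compose[OF measurable_snd]) auto
  show ?thesis
    unfolding angle_inner case_prod_beta by measurable
qed

lemma measurable_symb_angle [measurable]: "(\<lambda>u. symb P (angle u)) \<in> borel_measurable torus"
proof -
  have "case_prod (\<lambda>u z. 1 - cos (angle u \<bullet> real_vec z)) \<in> borel_measurable (torus \<Otimes>\<^sub>M measure_pmf P)"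
    using measurable_torus_pmf_inner[of P] unfolding case_prod_beta by measurable
  then show ?thesis
    unfolding symb_def by (rule measure_pmf.borel_measurable_lebesgue_integral)
qed

lemma measurable_angle_inner [measurable]: "(\<lambda>u. angle u \<bullet> real_vec z) \<in> borel_measurable torus"
  unfolding angle_inner by measurable

lemma symb_le: "symb P \<xi> \<le> 2"
proof -
  have "symb P \<xi> \<le> measure_pmf.expectation P (\<lambda>_. 2)"
    unfolding symb_def
  proof (rule integral_mono)
    show "1 - cos (\<xi> \<bullet> real_vec z) \<le> 2" for z
      using abs_cos_expr_le[of "\<xi> \<bullet> real_vec z"] by simp
  qed auto
  then show ?thesis
    by simp
qed

text \<open>The Fourier coefficients of the symbol are those of \<open>\<delta>\<^sub>0\<close> minus the step distribution.\<close>

lemma integral_torus_symb_cos: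
  fixes P :: "(int ^ 'd) pmf"
  assumes P: "symmetric_pmf P"
  shows "(\<integral>u. symb P (angle u) * cos (angle u \<bullet> real_vec w) \<partial>torus) = (if w = 0 then 1 else 0) - pmf P w"
proof -
  interpret T: prob_space "torus :: ('d \<Rightarrow> real) measure"
    by (rule prob_space_torus)
  interpret pair_prob_space "torus :: ('d \<Rightarrow> real) measure" "measure_pmf P"
    by unfold_locales
  let ?f = "\<lambda>u z. cos (angle u \<bullet> real_vec z) * cos (angle u \<bullet> real_vec w)"
  have int_f: "integrable (torus \<Otimes>\<^sub>M measure_pmf P) (case_prod ?f)"
  proof (rule integrable_const_bound[where B = 1])
    show "case_prod ?f \<in> borel_measurable (torus \<Otimes>\<^sub>M measure_pmf P)"
      using measurable_torus_pmf_inner[of P] measurable_compose[OF measurable_fst measurable_angle_inner[of w]]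
      unfolding case_prod_beta by measurable
    show "AE p in torus \<Otimes>\<^sub>M measure_pmf P. norm (case_prod ?f p) \<le> 1"
      by (auto simp: abs_mult intro!: AE_I2 mult_le_one)
  qed
  have int_cos: "integrable torus (\<lambda>u. cos (angle u \<bullet> real_vec z))" for z :: "int ^ 'd"
    by (rule integrable_torus_bounded[where C = 1]) auto
  have inner: "(\<integral>u. ?f u z \<partial>torus) = (indicator {- w} z + indicator {w} z) / 2" for z
  proof -
    have "(\<integral>u. ?f u z \<partial>torus)
        = (\<integral>u. (cos (angle u \<bullet> real_vec (z + w)) + cos (angle u \<bullet> real_vec (z - w))) / 2 \<partial>torus)"
      by (intro Bochner_Integration.integral_cong)
         (auto simp: inner_add_right inner_diff_right cos_add cos_diff)
    also have "\<dots> = ((\<integral>u. cos (angle u \<bullet> real_vec (z + w)) \<partial>torus) + (\<integral>u. cos (angle u \<bullet> real_vec (z - w)) \<partial>torus)) / 2"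
      unfolding integral_divide_zero by (subst Bochner_Integration.integral_add[OF int_cos int_cos]) simp
    also have "\<dots> = (indicator {- w} z + indicator {w} z) / 2"
      unfolding integral_torus_cos by (auto simp: indicator_def add_eq_0_iff2)
    finally show ?thesis .
  qed
  have "(\<integral>u. measure_pmf.expectation P (\<lambda>z. cos (angle u \<bullet> real_vec z)) * cos (angle u \<bullet> real_vec w) \<partial>torus)
      = (\<integral>u. measure_pmf.expectation P (\<lambda>z. ?f u z) \<partial>torus)"
    by simp
  also have "\<dots> = measure_pmf.expectation P (\<lambda>z. \<integral>u. ?f u z \<partial>torus)"
    by (rule Fubini_integral[symmetric, OF int_f])
  also have "\<dots> = measure_pmf.expectation P (\<lambda>z. (indicator {- w} z + indicator {w} z) / 2)"
    by (simp only: inner)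
  also have "\<dots> = (pmf P (- w) + pmf P w) / 2"
  proof -
    have int: "integrable (measure_pmf P) (indicator {v} :: _ \<Rightarrow> real)" for v
      by (rule integrable_pmf_bounded[where C = 1]) (simp add: indicator_def)
    show ?thesis
      unfolding integral_divide_zero
      by (subst Bochner_Integration.integral_add[OF int int]) (simp add: measure_pmf_single)
  qed
  also have "\<dots> = pmf P w"
    using P by (simp add: symmetric_pmf_def)
  finally have *: "(\<integral>u. measure_pmf.expectation P (\<lambda>z. cos (angle u \<bullet> real_vec z)) * cos (angle u \<bullet> real_vec w) \<partial>torus) = pmf P w" .
  have m: "(\<lambda>u. measure_pmf.expectation P (\<lambda>z. cos (angle u \<bullet> real_vec z))) = (\<lambda>u. 1 - symb P (angle u))"
    by (simp add: symb_eq)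
  have "(\<integral>u. symb P (angle u) * cos (angle u \<bullet> real_vec w) \<partial>torus)
      = (\<integral>u. cos (angle u \<bullet> real_vec w) - measure_pmf.expectation P (\<lambda>z. cos (angle u \<bullet> real_vec z)) * cos (angle u \<bullet> real_vec w) \<partial>torus)"
    by (simp add: symb_eq left_diff_distrib)
  also have "\<dots> = (if w = 0 then 1 else 0) - pmf P w"
  proof (subst Bochner_Integration.integral_diff[OF int_cos])
    show "integrable torus (\<lambda>u. measure_pmf.expectation P (\<lambda>z. cos (angle u \<bullet> real_vec z)) * cos (angle u \<bullet> real_vec w))"
    proof (rule integrable_torus_bounded[where C = "1 * 1"])
      show "(\<lambda>u. measure_pmf.expectation P (\<lambda>z. cos (angle u \<bullet> real_vec z)) * cos (angle u \<bullet> real_vec w)) \<in> borel_measurable torus"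
        using fun_cong[OF m] by simp
      fix u :: "'d \<Rightarrow> real"
      have "\<bar>1 - symb P (angle u)\<bar> \<le> 1"
        using symb_nonneg[of P "angle u"] symb_le[of P "angle u"] by linarith
      then show "norm (measure_pmf.expectation P (\<lambda>z. cos (angle u \<bullet> real_vec z)) * cos (angle u \<bullet> real_vec w)) \<le> 1 * 1"
        unfolding norm_mult using fun_cong[OF m, of u] by (intro mult_mono) auto
    qed
  qed (simp only: * integral_torus_cos)
  finally show ?thesis .
qed

section \<open>The Dirichlet form of finitely supported functions\<close>

text \<open>
  The quadratic form of minus the generator, evaluated at the restriction of \<open>f\<close> to the finite set
  \<open>F\<close>, extended by \<open>0\<close>. The values of \<open>f\<close> outside \<open>F\<close> play no role.
\<close>

definition dirichlet :: "(int ^ 'd) pmf \<Rightarrow> (int ^ 'd) set \<Rightarrow> (int ^ 'd \<Rightarrow> real) \<Rightarrow> real" where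
  "dirichlet P F f = (\<Sum>x\<in>F. (f x)\<^sup>2) - (\<Sum>x\<in>F. \<Sum>y\<in>F. pmf P (x - y) * f x * f y)"

text \<open>
  An integrable majorant \<open>W\<close> of the reciprocal of the symbol. Since the norm dominates every
  coordinate, \<open>norm \<theta> powr \<alpha>\<close> dominates the product of the \<open>\<bar>\<theta> $ i\<bar> powr (\<alpha> / d)\<close>, whose reciprocal is
  integrable because \<open>\<alpha> / d < 1\<close>.
\<close>

lemma torus_weight:
  fixes P :: "(int ^ 'd) pmf"
  assumes \<alpha>: "0 < \<alpha>" "\<alpha> < real CARD('d)" and c: "0 < c"
    and lower: "\<And>\<theta>. (\<And>i. \<bar>\<theta> $ i\<bar> \<le> pi) \<Longrightarrow> c * norm \<theta> powr \<alpha> \<le> symb P \<theta>"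
  obtains W where "integrable torus W" "\<And>u. u \<in> space torus \<Longrightarrow> 1 \<le> symb P (angle u) * W u"
    "\<And>u. 0 \<le> W u"
proof -
  interpret product_prob_space "\<lambda>_::'d. circle"
    by (rule product_prob_space_circle)
  define \<beta> where "\<beta> = \<alpha> / real CARD('d)"
  have \<beta>: "0 \<le> \<beta>" "\<beta> < 1" "\<beta> * real CARD('d) = \<alpha>"
    using \<alpha> by (auto simp: \<beta>_def)
  define W where "W = (\<lambda>u::'d \<Rightarrow> real. (1 / c) * (\<Prod>i\<in>UNIV. \<bar>u i\<bar> powr (- \<beta>)))"
  have W_nonneg: "0 \<le> W u" for u
    unfolding W_def using c by (intro mult_nonneg_nonneg prod_nonneg) auto
  have "integrable circle (\<lambda>x. \<bar>x\<bar> powr (- \<beta>))"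
  proof (rule integrableI_nonneg)
    show "(\<lambda>x. \<bar>x\<bar> powr (- \<beta>)) \<in> borel_measurable circle"
      by (rule measurable_circle) measurable
  qed (use nn_integral_circle_powr[OF \<beta>(1,2)] in auto)
  then have "integrable torus (\<lambda>u::'d \<Rightarrow> real. \<Prod>i\<in>UNIV. \<bar>u i\<bar> powr (- \<beta>))"
    unfolding torus_def by (intro product_integrable_prod) auto
  then have "integrable torus W"
    unfolding W_def by (rule integrable_mult_right)
  moreover have "1 \<le> symb P (angle u) * W u" if u: "u \<in> space torus" for u
  proof -
    have u_nz: "0 < \<bar>u i\<bar>" for i
      using space_torusD[OF u, of i] by simp
    have le: "\<bar>u i\<bar> \<le> norm (angle u)" for i
    proof -
      have "\<bar>u i\<bar> \<le> 2 * pi * \<bar>u i\<bar>"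
        using mult_right_mono[of 1 "2 * pi" "\<bar>u i\<bar>"] pi_gt3 by simp
      also have "\<dots> = \<bar>angle u $ i\<bar>"
        by (simp add: angle_def abs_mult)
      also have "\<dots> \<le> norm (angle u)"
        by (rule component_le_norm_cart)
      finally show ?thesis .
    qed
    have pos: "0 < norm (angle u)"
      using le u_nz by (meson less_le_trans)
    have "(\<Prod>i\<in>UNIV. \<bar>u i\<bar> powr \<beta>) \<le> (\<Prod>i\<in>(UNIV::'d set). norm (angle u) powr \<beta>)"
      using le \<beta>(1) by (intro prod_mono) (auto intro!: powr_mono2)
    also have "\<dots> = norm (angle u) powr \<alpha>"
      using pos \<beta>(3) by (simp add: powr_powr flip: powr_realpow)
    finally have prod_le: "(\<Prod>i\<in>UNIV. \<bar>u i\<bar> powr \<beta>) \<le> norm (angle u) powr \<alpha>" .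
    have "c * (\<Prod>i\<in>UNIV. \<bar>u i\<bar> powr \<beta>) \<le> c * norm (angle u) powr \<alpha>"
      using prod_le c by simp
    also have "\<dots> \<le> symb P (angle u)"
    proof (rule lower)
      fix i
      show "\<bar>angle u $ i\<bar> \<le> pi"
        using space_torusD[OF u, of i] mult_left_mono[of "\<bar>u i\<bar>" "1 / 2" "2 * pi"] by (simp add: angle_def abs_mult)
    qed
    finally have "c * (\<Prod>i\<in>UNIV. \<bar>u i\<bar> powr \<beta>) * W u \<le> symb P (angle u) * W u"
      using W_nonneg by (intro mult_right_mono)
    moreover have "c * (\<Prod>i\<in>UNIV. \<bar>u i\<bar> powr \<beta>) * W u = (\<Prod>i\<in>UNIV. \<bar>u i\<bar> powr \<beta> * \<bar>u i\<bar> powr (- \<beta>))"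
      using c by (simp add: W_def prod.distrib)
    moreover have "(\<Prod>i\<in>UNIV. \<bar>u i\<bar> powr \<beta> * \<bar>u i\<bar> powr (- \<beta>)) = 1"
      using u_nz by (intro prod.neutral ballI) (simp flip: powr_add)
    ultimately show ?thesis
      by simp
  qed
  ultimately show ?thesis
    using that W_nonneg by blast
qed

text \<open>
  Transience of the walk in the form of a Sobolev-type inequality. In Fourier variables centred at the
  point \<open>x\<^sub>0\<close>, the value \<open>f x\<^sub>0\<close> is the integral of the real part \<open>C\<close> of the transform and the Dirichlet
  form is the integral of \<open>N\<close>, the symbol times the squared modulus \<open>C\<^sup>2 + S\<^sup>2\<close>. The bound then follows
  from the pointwise inequality between arithmetic and geometric means.
\<close>

theorem dirichlet_pointwise_bound:
  fixes P :: "(int ^ 'd) pmf"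
  assumes P: "symmetric_pmf P"
    and \<alpha>: "0 < \<alpha>" "\<alpha> < real CARD('d)" and c: "0 < c"
    and lower: "\<And>\<theta>. (\<And>i. \<bar>\<theta> $ i\<bar> \<le> pi) \<Longrightarrow> c * norm \<theta> powr \<alpha> \<le> symb P \<theta>"
  obtains K where "0 < K" "\<And>F f x. finite F \<Longrightarrow> x \<in> F \<Longrightarrow> (f x)\<^sup>2 \<le> K * dirichlet P F f"
proof -
  interpret T: prob_space "torus :: ('d \<Rightarrow> real) measure"
    by (rule prob_space_torus)
  obtain W :: "('d \<Rightarrow> real) \<Rightarrow> real" where W: "integrable torus W" "\<And>u. u \<in> space torus \<Longrightarrow> 1 \<le> symb P (angle u) * W u"
    "\<And>u. 0 \<le> W u"
    using torus_weight[OF \<alpha> c lower] by metis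
  \<comment> \<open>The summand \<open>1\<close> only serves to make \<open>K\<close> positive.\<close>
  define K where "K = (\<integral>u. W u \<partial>torus) + 1"
  have int_W: "0 \<le> (\<integral>u. W u \<partial>torus)"
    using W(3) by (intro integral_nonneg_AE) auto
  then have K: "0 < K"
    by (simp add: K_def)
  have bound: "(f x\<^sub>0)\<^sup>2 \<le> K * dirichlet P F f" if F: "finite F" and x0: "x\<^sub>0 \<in> F" for F f x\<^sub>0
  proof -
    define C where "C = (\<lambda>u. \<Sum>x\<in>F. f x * cos (angle u \<bullet> real_vec (x - x\<^sub>0)))"
    define S where "S = (\<lambda>u. \<Sum>x\<in>F. f x * sin (angle u \<bullet> real_vec (x - x\<^sub>0)))"
    define N where "N = (\<lambda>u. \<Sum>x\<in>F. \<Sum>y\<in>F. f x * f y * (symb P (angle u) * cos (angle u \<bullet> real_vec (x - y))))"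
    have int_cos: "integrable torus (\<lambda>u. cos (angle u \<bullet> real_vec z))" for z :: "int ^ 'd"
      by (rule integrable_torus_bounded[where C = 1]) auto
    have int_symb: "integrable torus (\<lambda>u. symb P (angle u) * cos (angle u \<bullet> real_vec z))" for z :: "int ^ 'd"
    proof (rule integrable_torus_bounded[where C = "2 * 1"])
      fix u :: "'d \<Rightarrow> real"
      show "norm (symb P (angle u) * cos (angle u \<bullet> real_vec z)) \<le> 2 * 1"
        unfolding norm_mult using symb_nonneg[of P "angle u"] symb_le[of P "angle u"]
        by (intro mult_mono) auto
    qed measurable
    have N_eq: "N u = symb P (angle u) * ((C u)\<^sup>2 + (S u)\<^sup>2)" for u
    proof -
      have "(C u)\<^sup>2 + (S u)\<^sup>2 = (\<Sum>x\<in>F. \<Sum>y\<in>F. f x * f y * cos (angle u \<bullet> real_vec (x - y)))"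
      proof -
        have "f x * f y * cos (angle u \<bullet> real_vec (x - y)) =
            f x * cos (angle u \<bullet> real_vec (x - x\<^sub>0)) * (f y * cos (angle u \<bullet> real_vec (y - x\<^sub>0)))
            + f x * sin (angle u \<bullet> real_vec (x - x\<^sub>0)) * (f y * sin (angle u \<bullet> real_vec (y - x\<^sub>0)))" for x y
        proof -
          have "angle u \<bullet> real_vec (x - y) = angle u \<bullet> real_vec (x - x\<^sub>0) - angle u \<bullet> real_vec (y - x\<^sub>0)"
            by (simp add: inner_diff_right)
          then show ?thesis
            by (simp only: cos_diff) (simp only: algebra_simps)
        qed
        then show ?thesis
          unfolding C_def S_def power2_eq_square sum_product sum.distrib[symmetric] by presburger
      qed
      then show ?thesis
        by (simp add: N_def sum_distrib_left mult_ac)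
    qed
    have int_C: "integrable torus C"
      unfolding C_def using int_cos by (intro Bochner_Integration.integrable_sum integrable_mult_right)
    have int_N: "integrable torus N"
      unfolding N_def using int_symb by (intro Bochner_Integration.integrable_sum integrable_mult_right)
    have "(\<integral>u. C u \<partial>torus) = (\<Sum>x\<in>F. f x * (\<integral>u. cos (angle u \<bullet> real_vec (x - x\<^sub>0)) \<partial>torus))"
      unfolding C_def using int_cos
      by (subst Bochner_Integration.integral_sum) (auto simp del: real_vec_simps)
    also have "\<dots> = f x\<^sub>0"
      unfolding integral_torus_cos using F x0 by (simp add: sum.delta if_distrib cong: if_cong)
    finally have C_int: "(\<integral>u. C u \<partial>torus) = f x\<^sub>0" .
    have "(\<integral>u. N u \<partial>torus)
        = (\<Sum>x\<in>F. \<Sum>y\<in>F. f x * f y * (\<integral>u. symb P (angle u) * cos (angle u \<bullet> real_vec (x - y)) \<partial>torus))"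
      unfolding N_def using int_symb
      by (subst Bochner_Integration.integral_sum, (intro Bochner_Integration.integrable_sum integrable_mult_right, assumption))
         (auto simp del: real_vec_simps intro!: sum.cong simp: Bochner_Integration.integral_sum)
    also have "\<dots> = (\<Sum>x\<in>F. \<Sum>y\<in>F. (if x = y then f x * f y else 0) - pmf P (x - y) * f x * f y)"
      unfolding integral_torus_symb_cos[OF P] by (intro sum.cong refl) (auto simp: algebra_simps)
    also have "\<dots> = dirichlet P F f"
      using F by (simp add: dirichlet_def sum_subtractf sum.delta' power2_eq_square)
    finally have N_int: "(\<integral>u. N u \<partial>torus) = dirichlet P F f" .
    have ineq: "2 * s * C u \<le> N u + s\<^sup>2 * W u" if u: "u \<in> space torus" for s u
    proof -
      define p where "p = symb P (angle u)"
      have pW: "1 \<le> p * W u"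
        using W(2)[OF u] by (simp add: p_def)
      have "0 \<le> p"
        by (simp add: p_def symb_nonneg)
      with pW have p: "0 < p"
        by (cases "p = 0") auto
      have "0 \<le> (p * C u - s)\<^sup>2"
        by simp
      then have "p * (2 * s * C u) \<le> p * (p * (C u)\<^sup>2) + s\<^sup>2 * 1"
        by (simp add: power2_diff power_mult_distrib power2_eq_square algebra_simps)
      also have "\<dots> \<le> p * (p * (C u)\<^sup>2) + s\<^sup>2 * (p * W u)"
        using pW by (intro add_left_mono mult_left_mono) auto
      also have "\<dots> = p * (p * (C u)\<^sup>2 + s\<^sup>2 * W u)"
        by (simp add: algebra_simps)
      finally have "2 * s * C u \<le> p * (C u)\<^sup>2 + s\<^sup>2 * W u"
        using p by simp
      also have "p * (C u)\<^sup>2 \<le> N u"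
        unfolding N_eq p_def[symmetric] using p by (simp add: distrib_left)
      finally show ?thesis
        by simp
    qed
    have main: "2 * s * f x\<^sub>0 \<le> dirichlet P F f + s\<^sup>2 * K" for s
    proof -
      have "(\<integral>u. 2 * s * C u \<partial>torus) \<le> (\<integral>u. N u + s\<^sup>2 * W u \<partial>torus)"
        using int_C int_N W(1) ineq
        by (intro integral_mono Bochner_Integration.integrable_add integrable_mult_right) auto
      also have "\<dots> = dirichlet P F f + s\<^sup>2 * (\<integral>u. W u \<partial>torus)"
        using int_N W(1) N_int by (subst Bochner_Integration.integral_add) auto
      also have "\<dots> \<le> dirichlet P F f + s\<^sup>2 * K"
        by (simp add: K_def mult_left_mono)
      finally show ?thesis
        by (simp add: C_int)
    qed
    \<comment> \<open>The optimal parameter, up to the excess of \<open>K\<close> over the integral of \<open>W\<close>.\<close>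
    have "2 * (f x\<^sub>0 / K) * f x\<^sub>0 \<le> dirichlet P F f + (f x\<^sub>0 / K)\<^sup>2 * K"
      by (rule main)
    then show ?thesis
      using K by (simp add: field_simps power2_eq_square)
  qed
  show ?thesis
    using that[OF K bound] by blast
qed

section \<open>Summability of the potential\<close>

lemma summable_tail_small:
  fixes g :: "'a \<Rightarrow> real"
  assumes g: "g summable_on UNIV" and "0 < \<delta>" "finite A"
  obtains F where "finite F" "A \<subseteq> F" "infsum g (- F) < \<delta>"
proof -
  have "(sum g \<longlongrightarrow> infsum g UNIV) (finite_subsets_at_top UNIV)"
    using has_sum_infsum[OF g] by (simp add: has_sum_def)
  then have "\<forall>\<^sub>F F in finite_subsets_at_top UNIV. dist (sum g F) (infsum g UNIV) < \<delta>"
    using \<open>0 < \<delta>\<close> by (rule tendstoD)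
  moreover have "\<forall>\<^sub>F F in finite_subsets_at_top UNIV. finite F \<and> A \<subseteq> F"
    using \<open>finite A\<close> by (auto simp: eventually_finite_subsets_at_top)
  ultimately have "\<forall>\<^sub>F F in finite_subsets_at_top UNIV. (finite F \<and> A \<subseteq> F) \<and> dist (sum g F) (infsum g UNIV) < \<delta>"
    by (auto elim: eventually_elim2)
  then obtain F where F: "finite F" "A \<subseteq> F" "dist (sum g F) (infsum g UNIV) < \<delta>"
    by (metis (no_types, lifting) eventually_happens' finite_subsets_at_top_neq_bot)
  have "infsum g (UNIV - F) = infsum g UNIV - infsum g F"
    using F(1) by (intro infsum_Diff g summable_on_finite) auto
  then have "infsum g (- F) = infsum g UNIV - sum g F"
    using F(1) by (simp add: Compl_eq_Diff_UNIV)
  then show ?thesis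
    using F that by (auto simp: dist_real_def)
qed

text \<open>
  This is the bound of the \<open>l\<^sup>1\<close> norm of a convolution: the double family is reindexed by
  \<open>(x, z) \<mapsto> (x - z, - z)\<close>.
\<close>

lemma correlation_summable:
  fixes b :: "int ^ 'd \<Rightarrow> real"
  assumes b: "(\<lambda>z. \<bar>b z\<bar>) summable_on UNIV"
  shows "(\<lambda>x. \<bar>correlation b x\<bar>) summable_on UNIV"
proof -
  define f where "f = (\<lambda>(x, z). b (x - z) * b (- z))"
  define S where "S = (\<Sum>\<^sub>\<infinity>w. \<bar>b w\<bar>)"
  have S: "((\<lambda>w. \<bar>b w\<bar>) has_sum S) UNIV"
    unfolding S_def using b by (rule has_sum_infsum)
  have "(\<lambda>(z, w). \<bar>b z\<bar> * \<bar>b w\<bar>) summable_on UNIV \<times> UNIV"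
  proof (rule summable_on_SigmaI)
    show "((\<lambda>w. case (z, w) of (z, w) \<Rightarrow> \<bar>b z\<bar> * \<bar>b w\<bar>) has_sum \<bar>b z\<bar> * S) UNIV" for z
      using has_sum_cmult_right[OF S] by simp
    show "(\<lambda>z. \<bar>b z\<bar> * S) summable_on UNIV"
      using b by (rule summable_on_cmult_left)
  qed auto
  moreover have "bij_betw (\<lambda>(x, z). (x - z, - z)) UNIV (UNIV :: ((int ^ 'd) \<times> (int ^ 'd)) set)"
    by (rule bij_betw_byWitness[where f' = "\<lambda>(y, w). (y - w, - w)"]) auto
  ultimately have "(\<lambda>p. (\<lambda>(z, w). \<bar>b z\<bar> * \<bar>b w\<bar>) ((\<lambda>(x, z). (x - z, - z)) p)) summable_on UNIV"
    by (subst summable_on_reindex_bij_betw) auto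
  then have "(\<lambda>p. norm (f p)) summable_on UNIV \<times> UNIV"
    by (simp add: f_def case_prod_beta abs_mult)
  note Infinite_Sum.abs_summable_on_Sigma_iff[of f UNIV "\<lambda>_. UNIV", THEN iffD1, OF this]
  then have inner: "(\<lambda>z. norm (f (x, z))) summable_on UNIV"
      and outer: "(\<lambda>x. norm (\<Sum>\<^sub>\<infinity>z. norm (f (x, z)))) summable_on UNIV" for x
    by auto
  show ?thesis
  proof (rule summable_on_comparison_test[OF outer])
    fix x
    have "\<bar>correlation b x\<bar> \<le> (\<Sum>\<^sub>\<infinity>z. norm (f (x, z)))"
      using norm_infsum_bound[OF inner[of x]] by (simp add: correlation_def f_def)
    then show "\<bar>correlation b x\<bar> \<le> norm (\<Sum>\<^sub>\<infinity>z. norm (f (x, z)))"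
      by simp
  qed simp
qed

section \<open>The top eigenvalue of a finite section\<close>

lemma quadratic_nonneg_linear_coeff:
  fixes b c :: real
  assumes "\<And>t. 0 \<le> 2 * t * b + t\<^sup>2 * c"
  shows "b = 0"
proof (rule ccontr)
  assume "b \<noteq> 0"
  define s where "s = \<bar>c\<bar> + 1"
  have s: "0 < s" "c < s"
    by (auto simp: s_def)
  have "0 \<le> (2 * (- b / s) * b + (- b / s)\<^sup>2 * c) * s\<^sup>2"
    by (rule mult_nonneg_nonneg[OF assms zero_le_power2])
  also have "\<dots> = b\<^sup>2 * (c - 2 * s)"
    using s(1) by (simp add: field_simps power2_eq_square)
  also have "\<dots> < 0"
    using \<open>b \<noteq> 0\<close> s by (intro mult_pos_neg) auto
  finally show False
    by simp
qed

lemma compact_box_fun: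
  fixes S :: "'a \<Rightarrow> real set"
  assumes "\<And>x. compact (S x)"
  shows "compact {f. \<forall>x. f x \<in> S x}"
proof -
  have "compactin (product_topology (\<lambda>_. euclidean) UNIV) (PiE UNIV S)"
    using assms by (simp add: compactin_PiE)
  moreover have "PiE UNIV S = {f. \<forall>x. f x \<in> S x}"
    by (auto simp: PiE_def Pi_def)
  ultimately show ?thesis
    by (simp add: euclidean_product_topology)
qed

text \<open>
  A maximiser of a quadratic form on the unit sphere of the functions supported in \<open>F\<close> is an
  eigenvector, because the first variation vanishes in every coordinate direction.
\<close>

lemma finite_symmetric_top_eigenvalue:
  fixes q :: "'a \<Rightarrow> 'a \<Rightarrow> real"
  assumes F: "finite F" "F \<noteq> {}" and q_sym: "\<And>x y. q x y = q y x"
  obtains f \<mu> where "\<And>x. x \<notin> F \<Longrightarrow> f x = 0" "(\<Sum>x\<in>F. (f x)\<^sup>2) = 1"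
    "\<And>x. x \<in> F \<Longrightarrow> (\<Sum>y\<in>F. q x y * f y) = \<mu> * f x"
    "\<And>g. (\<Sum>x\<in>F. \<Sum>y\<in>F. q x y * g x * g y) \<le> \<mu> * (\<Sum>x\<in>F. (g x)\<^sup>2)"
proof -
  define Q where "Q = (\<lambda>g. \<Sum>x\<in>F. \<Sum>y\<in>F. q x y * g x * g y)"
  define N where "N = (\<lambda>g :: 'a \<Rightarrow> real. \<Sum>x\<in>F. (g x)\<^sup>2)"
  define K where "K = {f. \<forall>x. f x \<in> (if x \<in> F then {- 1..1} else {0::real})} \<inter> {f. N f = 1}"
  have cont_N: "continuous_on UNIV N"
    unfolding N_def by (intro continuous_intros) auto
  have cont_Q: "continuous_on UNIV Q"
    unfolding Q_def by (intro continuous_intros) auto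
  have "compact {f. \<forall>x. f x \<in> (if x \<in> F then {- 1..1} else {0::real})}"
    by (rule compact_box_fun) auto
  moreover have "closed {f. N f = 1}"
    using cont_N by (intro closed_Collect_eq continuous_on_const)
  ultimately have "compact K"
    unfolding K_def by (rule compact_Int_closed)
  moreover have "K \<noteq> {}"
  proof -
    obtain x\<^sub>0 where x0: "x\<^sub>0 \<in> F"
      using F(2) by blast
    have "N (\<lambda>x. if x = x\<^sub>0 then 1 else 0) = (\<Sum>x\<in>F. if x = x\<^sub>0 then 1 else 0)"
      unfolding N_def by (intro sum.cong) auto
    also have "\<dots> = 1"
      using x0 F(1) by simp
    finally have "(\<lambda>x. if x = x\<^sub>0 then 1 else 0) \<in> K"
      using x0 by (auto simp: K_def)
    then show ?thesis
      by blast
  qed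
  ultimately obtain f where f: "f \<in> K" "\<And>g. g \<in> K \<Longrightarrow> Q g \<le> Q f"
    using continuous_attains_sup[of K Q] continuous_on_subset[OF cont_Q] by auto
  define \<mu> where "\<mu> = Q f"
  have f_out: "f x = 0" if "x \<notin> F" for x
  proof -
    have "f x \<in> (if x \<in> F then {- 1..1} else {0})"
      using f(1) by (simp add: K_def)
    then show ?thesis
      using that by simp
  qed
  have f_norm: "N f = 1"
    using f(1) by (simp add: K_def)
  have max: "Q g \<le> \<mu> * N g" for g
  proof (cases "N g = 0")
    case True
    then have "g x = 0" if "x \<in> F" for x
      using that F(1) unfolding N_def by (subst (asm) sum_nonneg_eq_0_iff) auto
    then have "Q g = 0"
      unfolding Q_def by (intro sum.neutral ballI) auto
    then show ?thesis
      using True by simp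
  next
    case False
    have "0 \<le> N g"
      unfolding N_def by (intro sum_nonneg) auto
    with False have pos: "0 < N g"
      by simp
    define h where "h = (\<lambda>x. if x \<in> F then g x / sqrt (N g) else 0)"
    have N_h: "N h = 1"
    proof -
      have "N h = (\<Sum>x\<in>F. (g x)\<^sup>2 / N g)"
        unfolding fun_cong[OF N_def, of h] using pos by (simp add: h_def power_divide)
      also have "\<dots> = (\<Sum>x\<in>F. (g x)\<^sup>2) / N g"
        by (rule sum_divide_distrib[symmetric])
      also have "(\<Sum>x\<in>F. (g x)\<^sup>2) = N g"
        by (simp add: N_def)
      finally show ?thesis
        using pos by simp
    qed
    have "h x \<in> {- 1..1}" if "x \<in> F" for x
    proof -
      have "(h x)\<^sup>2 \<le> N h"
        unfolding N_def using that F(1) by (intro member_le_sum) auto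
      then show ?thesis
        by (simp add: N_h abs_square_le_1 abs_le_iff)
    qed
    then have "h \<in> K"
      using N_h by (auto simp: K_def h_def)
    then have "Q h \<le> \<mu>"
      unfolding \<mu>_def by (rule f(2))
    moreover have "Q h = Q g / N g"
    proof -
      have "Q h = (\<Sum>x\<in>F. \<Sum>y\<in>F. q x y * g x * g y / N g)"
        unfolding Q_def using pos by (intro sum.cong) (auto simp: h_def)
      then show ?thesis
        by (simp add: Q_def sum_divide_distrib)
    qed
    ultimately show ?thesis
      using pos by (simp add: pos_divide_le_eq)
  qed
  have eigen: "(\<Sum>y\<in>F. q x y * f y) = \<mu> * f x" if x: "x \<in> F" for x
  proof -
    have "0 \<le> 2 * t * (\<mu> * f x - (\<Sum>y\<in>F. q x y * f y)) + t\<^sup>2 * (\<mu> - q x x)" for t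
    proof -
      define d where "d = (\<lambda>y. if y = x then 1 else 0 :: real)"
      have d_sum: "(\<Sum>y\<in>F. h y * d y) = h x" for h
        using x F(1) by (simp add: d_def if_distrib cong: if_cong)
      have "N (\<lambda>y. f y + t * d y) = (\<Sum>y\<in>F. (f y)\<^sup>2) + (\<Sum>y\<in>F. (2 * t * f y + t\<^sup>2 * d y) * d y)"
        unfolding N_def sum.distrib[symmetric]
        by (intro sum.cong refl) (simp add: power2_eq_square algebra_simps)
      then have N1: "N (\<lambda>y. f y + t * d y) = 1 + 2 * t * f x + t\<^sup>2"
        unfolding d_sum using f_norm by (simp add: N_def d_def)
      have "Q (\<lambda>y. f y + t * d y) = Q f + (\<Sum>y\<in>F. \<Sum>z\<in>F. (q y z * t * f y) * d z)
          + (\<Sum>y\<in>F. (\<Sum>z\<in>F. (q y z * t * f z)) * d y) + (\<Sum>y\<in>F. (\<Sum>z\<in>F. (q y z * t\<^sup>2) * d z) * d y)"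
        unfolding Q_def sum_distrib_right sum.distrib[symmetric]
        by (intro sum.cong refl) (simp add: power2_eq_square algebra_simps)
      also have "\<dots> = \<mu> + 2 * t * (\<Sum>y\<in>F. q x y * f y) + t\<^sup>2 * q x x"
      proof -
        have "(\<Sum>y\<in>F. q y x * t * f y) = t * (\<Sum>y\<in>F. q x y * f y)"
          unfolding sum_distrib_left by (intro sum.cong refl) (subst q_sym, simp)
        moreover have "(\<Sum>z\<in>F. q x z * t * f z) = t * (\<Sum>y\<in>F. q x y * f y)"
          by (simp add: sum_distrib_left mult_ac)
        ultimately show ?thesis
          unfolding d_sum \<mu>_def by simp
      qed
      finally have Q1: "Q (\<lambda>y. f y + t * d y) = \<mu> + 2 * t * (\<Sum>y\<in>F. q x y * f y) + t\<^sup>2 * q x x" .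
      show ?thesis
        using max[of "\<lambda>y. f y + t * d y"] unfolding N1 Q1 by (simp add: algebra_simps)
    qed
    from quadratic_nonneg_linear_coeff[OF this] show ?thesis
      by simp
  qed
  show ?thesis
    using that[OF f_out f_norm[unfolded N_def] eigen max[unfolded Q_def N_def]] by blast
qed

section \<open>Positive eigenvalues and the quadratic form\<close>

lemma pmf_symmetric_diff: "symmetric_pmf P \<Longrightarrow> pmf P (x - y) = pmf P (y - x)"
  unfolding symmetric_pmf_def by (drule spec[of _ "y - x"]) simp

lemma expectation_shift_finite_support:
  fixes f :: "int ^ 'd \<Rightarrow> real"
  assumes P: "symmetric_pmf P" and F: "finite F" and out: "\<And>y. y \<notin> F \<Longrightarrow> f y = 0"
  shows "measure_pmf.expectation P (\<lambda>z. f (x + z)) = (\<Sum>y\<in>F. pmf P (x - y) * f y)"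
proof -
  have "measure_pmf.expectation P (\<lambda>z. f (x + z)) = (\<Sum>z\<in>(\<lambda>y. y - x) ` F. f (x + z) * pmf P z)"
  proof (rule integral_measure_pmf_real)
    fix z assume "f (x + z) \<noteq> 0"
    then have "x + z \<in> F"
      using out by blast
    then show "z \<in> (\<lambda>y. y - x) ` F"
      by (intro image_eqI[of _ _ "x + z"]) auto
  qed (use F in auto)
  also have "\<dots> = (\<Sum>y\<in>F. f (x + (y - x)) * pmf P (y - x))"
    by (subst sum.reindex) (auto simp: inj_on_def)
  also have "\<dots> = (\<Sum>y\<in>F. pmf P (x - y) * f y)"
    using pmf_symmetric_diff[OF P, of x] by (simp add: mult.commute)
  finally show ?thesis .
qed

text \<open>The quadratic form of the operator on functions supported in a finite set.\<close>

lemma quadratic_form_dirichlet: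
  assumes F: "finite F"
  shows "(\<Sum>x\<in>F. \<Sum>y\<in>F. ((if x = y then B x - 2 * \<kappa> else 0) + 2 * \<kappa> * pmf P (x - y)) * g x * g y)
    = (\<Sum>x\<in>F. B x * (g x)\<^sup>2) - 2 * \<kappa> * dirichlet P F g"
proof -
  have "(\<Sum>x\<in>F. \<Sum>y\<in>F. ((if x = y then B x - 2 * \<kappa> else 0) + 2 * \<kappa> * pmf P (x - y)) * g x * g y)
      = (\<Sum>x\<in>F. (\<Sum>y\<in>F. if x = y then (B x - 2 * \<kappa>) * (g x)\<^sup>2 else 0)
          + 2 * \<kappa> * (\<Sum>y\<in>F. pmf P (x - y) * g x * g y))"
    unfolding sum_distrib_left sum.distrib[symmetric]
    by (intro sum.cong refl) (auto simp: algebra_simps power2_eq_square)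
  also have "\<dots> = (\<Sum>x\<in>F. (B x * (g x)\<^sup>2 - 2 * \<kappa> * (g x)\<^sup>2)
          + 2 * \<kappa> * (\<Sum>y\<in>F. pmf P (x - y) * g x * g y))"
    using F by (intro sum.cong refl) (simp add: left_diff_distrib)
  also have "\<dots> = (\<Sum>x\<in>F. B x * (g x)\<^sup>2) - 2 * \<kappa> * dirichlet P F g"
    by (simp add: dirichlet_def sum.distrib sum_subtractf sum_distrib_left right_diff_distrib)
  finally show ?thesis .
qed

text \<open>
  If the quadratic form is positive somewhere, then a positive eigenvalue exists. The eigenpairs of
  the top eigenvalue in an exhausting sequence of finite sections have a pointwise limit along a
  subsequence, and the eigenvalue equation passes to the limit. The limit function is not zero:
  the potential term of each section is at least the eigenvalue, hence bounded below, and the summable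
  potential prevents this mass from escaping to infinity.
\<close>

theorem positive_eigenfunction_exists:
  fixes P :: "(int ^ 'd) pmf"
  assumes P: "symmetric_pmf P" and \<kappa>: "0 < \<kappa>"
    and dirichlet_nonneg: "\<And>F f. finite F \<Longrightarrow> 0 \<le> dirichlet P F f"
    and B: "(\<lambda>x. \<bar>B x\<bar>) summable_on UNIV"
    and F\<^sub>0: "finite F\<^sub>0" and pos: "2 * \<kappa> * dirichlet P F\<^sub>0 f\<^sub>0 < (\<Sum>x\<in>F\<^sub>0. B x * (f\<^sub>0 x)\<^sup>2)"
  obtains u \<mu> where "0 < \<mu>" "\<And>x. \<bar>u x\<bar> \<le> 1" "(\<lambda>x. (u x)\<^sup>2) summable_on UNIV" "u \<noteq> (\<lambda>_. 0)"
    "\<And>x. 2 * \<kappa> * (measure_pmf.expectation P (\<lambda>z. u (x + z)) - u x) + B x * u x = \<mu> * u x"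
proof -
  define q where "q = (\<lambda>x y. (if x = y then B x - 2 * \<kappa> else 0) + 2 * \<kappa> * pmf P (x - y))"
  have q_sym: "q x y = q y x" for x y
    using pmf_symmetric_diff[OF P] by (auto simp: q_def)
  define F where "F = (\<lambda>n::nat. F\<^sub>0 \<union> from_nat ` {..n})"
  have F_fin: "finite (F n)" for n
    using F\<^sub>0 by (simp add: F_def)
  have F_ne: "F n \<noteq> {}" for n
    by (auto simp: F_def)
  have F_ev: "\<forall>\<^sub>F n in sequentially. x \<in> F n" for x :: "int ^ 'd"
    unfolding eventually_sequentially
  proof (intro exI[of _ "to_nat x"] allI impI)
    fix n assume "to_nat x \<le> n"
    then have "from_nat (to_nat x) \<in> (from_nat ` {..n} :: (int ^ 'd) set)"
      by blast
    then show "x \<in> F n"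
      by (simp add: F_def)
  qed
  define top_pair where "top_pair = (\<lambda>n f \<mu>. (\<forall>x. x \<notin> F n \<longrightarrow> f x = 0) \<and> (\<Sum>x\<in>F n. (f x)\<^sup>2) = 1
      \<and> (\<forall>x\<in>F n. (\<Sum>y\<in>F n. q x y * f y) = \<mu> * f x)
      \<and> (\<forall>g. (\<Sum>x\<in>F n. \<Sum>y\<in>F n. q x y * g x * g y) \<le> \<mu> * (\<Sum>x\<in>F n. (g x)\<^sup>2)))"
  have "\<exists>p. top_pair n (fst p) (snd p)" for n
  proof -
    obtain f \<mu> where "\<And>x. x \<notin> F n \<Longrightarrow> f x = 0" "(\<Sum>x\<in>F n. (f x)\<^sup>2) = 1"
      "\<And>x. x \<in> F n \<Longrightarrow> (\<Sum>y\<in>F n. q x y * f y) = \<mu> * f x"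
      "\<And>g. (\<Sum>x\<in>F n. \<Sum>y\<in>F n. q x y * g x * g y) \<le> \<mu> * (\<Sum>x\<in>F n. (g x)\<^sup>2)"
      using finite_symmetric_top_eigenvalue[of "F n" q, OF F_fin F_ne q_sym] by blast
    then show ?thesis
      unfolding top_pair_def by (intro exI[of _ "(f, \<mu>)"]) simp
  qed
  then obtain p where p: "\<And>n. top_pair n (fst (p n)) (snd (p n))"
    by metis
  define f where "f = (\<lambda>n. fst (p n))"
  define \<mu> where "\<mu> = (\<lambda>n. snd (p n))"
  have top_pair: "top_pair n (f n) (\<mu> n)" for n
    using p by (simp add: f_def \<mu>_def)
  have f_out: "f n x = 0" if "x \<notin> F n" for n x
    using top_pair[of n] that by (simp add: top_pair_def)
  have f_norm: "(\<Sum>x\<in>F n. (f n x)\<^sup>2) = 1" for n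
    using top_pair[of n] by (simp add: top_pair_def)
  have f_eig: "(\<Sum>y\<in>F n. q x y * f n y) = \<mu> n * f n x" if "x \<in> F n" for n x
    using top_pair[of n] that by (simp add: top_pair_def)
  have max: "(\<Sum>x\<in>F n. \<Sum>y\<in>F n. q x y * g x * g y) \<le> \<mu> n * (\<Sum>x\<in>F n. (g x)\<^sup>2)" for n g
    using top_pair[of n] by (simp add: top_pair_def)
  have Q: "(\<Sum>x\<in>G. \<Sum>y\<in>G. q x y * g x * g y) = (\<Sum>x\<in>G. B x * (g x)\<^sup>2) - 2 * \<kappa> * dirichlet P G g"
    if "finite G" for G g
    unfolding q_def by (rule quadratic_form_dirichlet[OF that])
  have f_sq: "(\<Sum>x\<in>G. (f n x)\<^sup>2) \<le> 1" if "finite G" for n G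
  proof -
    have "(\<Sum>x\<in>G. (f n x)\<^sup>2) = (\<Sum>x\<in>G \<inter> F n. (f n x)\<^sup>2)"
      using that f_out by (intro sum.mono_neutral_right) auto
    also have "\<dots> \<le> (\<Sum>x\<in>F n. (f n x)\<^sup>2)"
      using F_fin by (intro sum_mono2) auto
    finally show ?thesis
      by (simp add: f_norm)
  qed
  have f_sq_le: "(f n x)\<^sup>2 \<le> 1" for n x
    using f_sq[of "{x}" n] by simp
  then have f_abs: "\<bar>f n x\<bar> \<le> 1" for n x
    by (simp add: abs_square_le_1)
  have f_lin: "2 * \<kappa> * (measure_pmf.expectation P (\<lambda>z. f n (x + z)) - f n x) + B x * f n x = \<mu> n * f n x"
    if x: "x \<in> F n" for n x
  proof -
    have "(\<Sum>y\<in>F n. q x y * f n y)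
        = (\<Sum>y\<in>F n. if x = y then (B x - 2 * \<kappa>) * f n y else 0) + 2 * \<kappa> * (\<Sum>y\<in>F n. pmf P (x - y) * f n y)"
      unfolding q_def sum_distrib_left sum.distrib[symmetric]
      by (intro sum.cong refl) (auto simp: algebra_simps)
    also have "\<dots> = (B x - 2 * \<kappa>) * f n x + 2 * \<kappa> * measure_pmf.expectation P (\<lambda>z. f n (x + z))"
    proof -
      have "measure_pmf.expectation P (\<lambda>z. f n (x + z)) = (\<Sum>y\<in>F n. pmf P (x - y) * f n y)"
        by (rule expectation_shift_finite_support[OF P F_fin f_out])
      then show ?thesis
        using x F_fin by simp
    qed
    finally show ?thesis
      using f_eig[OF x] by (simp add: algebra_simps)
  qed
  \<comment> \<open>The eigenvalues of the sections stay in a compact subinterval of the positive half line.\<close>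
  define m where "m = ((\<Sum>x\<in>F\<^sub>0. B x * (f\<^sub>0 x)\<^sup>2) - 2 * \<kappa> * dirichlet P F\<^sub>0 f\<^sub>0) / (\<Sum>x\<in>F\<^sub>0. (f\<^sub>0 x)\<^sup>2)"
  have norm_f0: "0 < (\<Sum>x\<in>F\<^sub>0. (f\<^sub>0 x)\<^sup>2)"
  proof (rule ccontr)
    assume "\<not> 0 < (\<Sum>x\<in>F\<^sub>0. (f\<^sub>0 x)\<^sup>2)"
    then have "(\<Sum>x\<in>F\<^sub>0. (f\<^sub>0 x)\<^sup>2) = 0"
      using sum_nonneg[of F\<^sub>0 "\<lambda>x. (f\<^sub>0 x)\<^sup>2"] by simp
    then have "f\<^sub>0 x = 0" if "x \<in> F\<^sub>0" for x
      using that F\<^sub>0 by (subst (asm) sum_nonneg_eq_0_iff) auto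
    then have "(\<Sum>x\<in>F\<^sub>0. B x * (f\<^sub>0 x)\<^sup>2) = 0"
      by (intro sum.neutral) auto
    moreover have "0 \<le> 2 * \<kappa> * dirichlet P F\<^sub>0 f\<^sub>0"
      using \<kappa> dirichlet_nonneg[OF F\<^sub>0] by simp
    ultimately show False
      using pos by simp
  qed
  have m: "0 < m"
    using pos norm_f0 by (simp add: m_def)
  have \<mu>_lower: "m \<le> \<mu> n" for n
  proof -
    define g where "g = (\<lambda>x. if x \<in> F\<^sub>0 then f\<^sub>0 x else 0)"
    have sub: "F\<^sub>0 \<subseteq> F n"
      by (auto simp: F_def)
    have "(\<Sum>x\<in>F n. (g x)\<^sup>2) = (\<Sum>x\<in>F\<^sub>0. (f\<^sub>0 x)\<^sup>2)"
      using sub F_fin by (intro sum.mono_neutral_cong_right) (auto simp: g_def)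
    moreover have "(\<Sum>x\<in>F n. \<Sum>y\<in>F n. q x y * g x * g y) = (\<Sum>x\<in>F\<^sub>0. \<Sum>y\<in>F n. q x y * f\<^sub>0 x * g y)"
      using sub F_fin by (intro sum.mono_neutral_cong_right) (auto simp: g_def)
    moreover have "\<dots> = (\<Sum>x\<in>F\<^sub>0. \<Sum>y\<in>F\<^sub>0. q x y * f\<^sub>0 x * f\<^sub>0 y)"
    proof (rule sum.cong[OF refl])
      fix x
      show "(\<Sum>y\<in>F n. q x y * f\<^sub>0 x * g y) = (\<Sum>y\<in>F\<^sub>0. q x y * f\<^sub>0 x * f\<^sub>0 y)"
        using sub F_fin by (intro sum.mono_neutral_cong_right) (auto simp: g_def)
    qed
    ultimately have "m * (\<Sum>x\<in>F\<^sub>0. (f\<^sub>0 x)\<^sup>2) \<le> \<mu> n * (\<Sum>x\<in>F\<^sub>0. (f\<^sub>0 x)\<^sup>2)"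
      using max[of g n] Q[OF F\<^sub>0, of f\<^sub>0] norm_f0 by (simp add: m_def)
    then show ?thesis
      using norm_f0 by simp
  qed
  have \<mu>_le: "\<mu> n \<le> (\<Sum>x\<in>F n. B x * (f n x)\<^sup>2)" for n
  proof -
    have "\<mu> n = (\<Sum>x\<in>F n. f n x * (\<mu> n * f n x))"
      using f_norm[of n] by (simp add: power2_eq_square sum_distrib_left[symmetric] mult.left_commute)
    also have "\<dots> = (\<Sum>x\<in>F n. f n x * (\<Sum>y\<in>F n. q x y * f n y))"
      by (intro sum.cong refl) (simp add: f_eig)
    also have "\<dots> = (\<Sum>x\<in>F n. \<Sum>y\<in>F n. q x y * f n x * f n y)"
      by (simp add: sum_distrib_left mult_ac)
    also have "\<dots> = (\<Sum>x\<in>F n. B x * (f n x)\<^sup>2) - 2 * \<kappa> * dirichlet P (F n) (f n)"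
      by (rule Q[OF F_fin])
    also have "\<dots> \<le> (\<Sum>x\<in>F n. B x * (f n x)\<^sup>2)"
      using \<kappa> dirichlet_nonneg[OF F_fin] by simp
    finally show ?thesis .
  qed
  have Bf_le: "B x * (f n x)\<^sup>2 \<le> \<bar>B x\<bar>" for n x
  proof -
    have "B x * (f n x)\<^sup>2 \<le> \<bar>B x\<bar> * 1"
      using f_sq_le by (intro mult_mono) auto
    then show ?thesis by simp
  qed
  define b where "b = (\<Sum>\<^sub>\<infinity>x. \<bar>B x\<bar>)"
  have \<mu>_upper: "\<mu> n \<le> b" for n
  proof -
    have "(\<Sum>x\<in>F n. B x * (f n x)\<^sup>2) \<le> (\<Sum>x\<in>F n. \<bar>B x\<bar>)"
      by (intro sum_mono Bf_le)
    also have "\<dots> \<le> b"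
      unfolding b_def using B F_fin by (intro finite_sum_le_infsum) auto
    finally show ?thesis
      using \<mu>_le[of n] by simp
  qed
  \<comment> \<open>A subsequence converges pointwise, together with the eigenvalues.\<close>
  have "compact {f :: int ^ 'd \<Rightarrow> real. \<forall>x. f x \<in> {- 1..1}}"
    by (rule compact_box_fun) auto
  note box = compact_imp_seq_compact[OF this]
  have f_box: "\<forall>n. f n \<in> {f. \<forall>x. f x \<in> {- 1..1}}"
    using f_abs by (auto simp: abs_le_iff)
  obtain u r where r: "strict_mono (r :: nat \<Rightarrow> nat)" "(f \<circ> r) \<longlonglongrightarrow> u"
    by (rule seq_compactE[OF box f_box])
  have \<mu>_box: "\<forall>n. \<mu> (r n) \<in> {m..b}"
    using \<mu>_lower \<mu>_upper by simp
  obtain \<nu> s where s: "strict_mono (s :: nat \<Rightarrow> nat)" "((\<lambda>n. \<mu> (r n)) \<circ> s) \<longlonglongrightarrow> \<nu>" "\<nu> \<in> {m..b}"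
    by (rule seq_compactE[OF compact_imp_seq_compact[OF compact_Icc] \<mu>_box])
  define t where "t = r \<circ> s"
  have t: "strict_mono t"
    unfolding t_def using r(1) s(1) by (rule strict_mono_o)
  have \<mu>_lim: "(\<lambda>n. \<mu> (t n)) \<longlonglongrightarrow> \<nu>"
    using s(2) by (simp add: t_def o_def)
  have f_lim: "(\<lambda>n. f (t n) x) \<longlonglongrightarrow> u x" for x
  proof -
    have "(\<lambda>n. f (t n)) \<longlonglongrightarrow> u"
      using LIMSEQ_subseq_LIMSEQ[OF r(2) s(1)] by (simp add: t_def o_def)
    moreover have "continuous_on UNIV (\<lambda>f :: int ^ 'd \<Rightarrow> real. f x)"
      by (rule continuous_on_product_coordinates)
    then have "isCont (\<lambda>f. f x) u"
      using continuous_on_eq_continuous_at[OF open_UNIV] by blast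
    ultimately show ?thesis
      by (rule isCont_tendsto_compose[rotated])
  qed
  have u_abs: "\<bar>u x\<bar> \<le> 1" for x
    by (rule tendsto_upperbound[OF tendsto_rabs[OF f_lim]]) (auto intro: always_eventually f_abs)
  have u_summable: "(\<lambda>x. (u x)\<^sup>2) summable_on UNIV"
  proof (rule nonneg_bdd_above_summable_on)
    show "bdd_above (sum (\<lambda>x. (u x)\<^sup>2) ` {F. F \<subseteq> UNIV \<and> finite F})"
    proof (rule bdd_aboveI2)
      fix G :: "(int ^ 'd) set" assume "G \<in> {F. F \<subseteq> UNIV \<and> finite F}"
      then have G: "finite G" by simp
      have "(\<lambda>n. \<Sum>x\<in>G. (f (t n) x)\<^sup>2) \<longlonglongrightarrow> (\<Sum>x\<in>G. (u x)\<^sup>2)"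
        by (intro tendsto_intros f_lim)
      then show "(\<Sum>x\<in>G. (u x)\<^sup>2) \<le> 1"
        by (rule tendsto_upperbound) (auto intro!: always_eventually f_sq G)
    qed
  qed auto
  have u_eig: "2 * \<kappa> * (measure_pmf.expectation P (\<lambda>z. u (x + z)) - u x) + B x * u x = \<nu> * u x" for x
  proof -
    have E_lim: "(\<lambda>n. measure_pmf.expectation P (\<lambda>z. f (t n) (x + z))) \<longlonglongrightarrow> measure_pmf.expectation P (\<lambda>z. u (x + z))"
      by (rule integral_dominated_convergence[where w = "\<lambda>_. 1"]) (use f_lim f_abs in auto)
    have "(\<lambda>n. 2 * \<kappa> * (measure_pmf.expectation P (\<lambda>z. f (t n) (x + z)) - f (t n) x) + B x * f (t n) x)
        \<longlonglongrightarrow> 2 * \<kappa> * (measure_pmf.expectation P (\<lambda>z. u (x + z)) - u x) + B x * u x"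
      by (intro tendsto_intros E_lim f_lim)
    moreover have "\<forall>\<^sub>F n in sequentially. 2 * \<kappa> * (measure_pmf.expectation P (\<lambda>z. f (t n) (x + z)) - f (t n) x) + B x * f (t n) x
        = \<mu> (t n) * f (t n) x"
      using eventually_subseq[OF t F_ev[of x]] by eventually_elim (rule f_lin)
    ultimately have "(\<lambda>n. \<mu> (t n) * f (t n) x) \<longlonglongrightarrow> 2 * \<kappa> * (measure_pmf.expectation P (\<lambda>z. u (x + z)) - u x) + B x * u x"
      by (rule Lim_transform_eventually)
    moreover have "(\<lambda>n. \<mu> (t n) * f (t n) x) \<longlonglongrightarrow> \<nu> * u x"
      by (intro tendsto_intros \<mu>_lim f_lim)
    ultimately show ?thesis
      by (rule LIMSEQ_unique)
  qed
  \<comment> \<open>The limit does not vanish, because the potential is summable and keeps the mass in a finite set.\<close>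
  have "u \<noteq> (\<lambda>_. 0)"
  proof
    assume u0: "u = (\<lambda>_. 0)"
    obtain G where G: "finite G" "infsum (\<lambda>x. \<bar>B x\<bar>) (- G) < m / 2"
      using summable_tail_small[OF B, of "m / 2" "{}"] m by auto
    have bound: "m / 2 \<le> (\<Sum>x\<in>G. \<bar>B x\<bar> * (f n x)\<^sup>2)" for n
    proof -
      have "m \<le> (\<Sum>x\<in>F n. B x * (f n x)\<^sup>2)"
        using \<mu>_lower[of n] \<mu>_le[of n] by simp
      also have "\<dots> = (\<Sum>x\<in>F n \<inter> G. B x * (f n x)\<^sup>2) + (\<Sum>x\<in>F n - G. B x * (f n x)\<^sup>2)"
        using F_fin by (simp add: sum.Int_Diff)
      also have "(\<Sum>x\<in>F n \<inter> G. B x * (f n x)\<^sup>2) \<le> (\<Sum>x\<in>F n \<inter> G. \<bar>B x\<bar> * (f n x)\<^sup>2)"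
        by (intro sum_mono mult_right_mono) auto
      also have "(\<Sum>x\<in>F n \<inter> G. \<bar>B x\<bar> * (f n x)\<^sup>2) \<le> (\<Sum>x\<in>G. \<bar>B x\<bar> * (f n x)\<^sup>2)"
        using G(1) by (intro sum_mono2) auto
      also have "(\<Sum>x\<in>F n - G. B x * (f n x)\<^sup>2) \<le> (\<Sum>x\<in>F n - G. \<bar>B x\<bar>)"
        by (intro sum_mono Bf_le)
      also have "\<dots> \<le> infsum (\<lambda>x. \<bar>B x\<bar>) (- G)"
        using F_fin by (intro finite_sum_le_infsum summable_on_subset_banach[OF B]) auto
      finally show ?thesis
        using G(2) by simp
    qed
    have "(\<lambda>n. \<Sum>x\<in>G. \<bar>B x\<bar> * (f (t n) x)\<^sup>2) \<longlonglongrightarrow> (\<Sum>x\<in>G. \<bar>B x\<bar> * (u x)\<^sup>2)"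
      by (intro tendsto_intros f_lim)
    then have "m / 2 \<le> (\<Sum>x\<in>G. \<bar>B x\<bar> * (u x)\<^sup>2)"
      by (rule tendsto_lowerbound) (simp_all only: bound eventually_True trivial_limit_sequentially not_False_eq_True)
    then show False
      using m by (simp add: u0)
  qed
  then show ?thesis
    using that[OF _ u_abs u_summable _ u_eig] m s(3) by auto
qed

text \<open>
  Conversely, truncating an eigenfunction to a large finite set \<open>F\<close> changes the value \<open>\<mu> * N\<close> of the
  form by a boundary term \<open>R\<close>, which the inequality between arithmetic and geometric means bounds by a
  small multiple of \<open>N\<close> plus the tail \<open>\<tau>\<close> of the squared norm outside \<open>F\<close>.
\<close>

theorem quadratic_form_positive_of_eigenfunction:
  fixes P :: "(int ^ 'd) pmf"
  assumes P: "symmetric_pmf P" and \<kappa>: "0 < \<kappa>" and \<mu>: "0 < \<mu>"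
    and sq: "(\<lambda>x. (u x)\<^sup>2) summable_on UNIV" and nz: "u x\<^sub>1 \<noteq> 0"
    and eig: "\<And>x. 2 * \<kappa> * (measure_pmf.expectation P (\<lambda>z. u (x + z)) - u x) + B x * u x = \<mu> * u x"
  obtains F where "finite F" "2 * \<kappa> * dirichlet P F u < (\<Sum>x\<in>F. B x * (u x)\<^sup>2)"
proof -
  define \<eta> where "\<eta> = (u x\<^sub>1)\<^sup>2"
  have \<eta>: "0 < \<eta>"
    using nz by (simp add: \<eta>_def)
  \<comment> \<open>With this choice the first part of the boundary term is half of the main term.\<close>
  define \<epsilon> where "\<epsilon> = \<mu> / (2 * \<kappa>)"
  have \<epsilon>: "0 < \<epsilon>"
    using \<mu> \<kappa> by (simp add: \<epsilon>_def)
  obtain F where F: "finite F" "{x\<^sub>1} \<subseteq> F" "infsum (\<lambda>x. (u x)\<^sup>2) (- F) < \<epsilon> * (\<mu> / 2 * \<eta>) / \<kappa>"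
    by (rule summable_tail_small[OF sq, of "\<epsilon> * (\<mu> / 2 * \<eta>) / \<kappa>" "{x\<^sub>1}"]) (use \<epsilon> \<mu> \<eta> \<kappa> in auto)
  define v where "v = (\<lambda>x. if x \<in> F then u x else 0)"
  define w where "w = (\<lambda>x. if x \<in> F then 0 else u x)"
  define \<tau> where "\<tau> = infsum (\<lambda>x. (u x)\<^sup>2) (- F)"
  obtain C where C: "\<And>x. \<bar>u x\<bar> \<le> C"
  proof -
    have "\<bar>u x\<bar> \<le> sqrt (infsum (\<lambda>x. (u x)\<^sup>2) UNIV)" for x
      using finite_sum_le_infsum[OF sq, of "{x}"] by (intro real_le_rsqrt) simp
    then show ?thesis
      using that by blast
  qed
  have C0: "0 \<le> C"
    using C[of 0] by simp
  have w_le: "\<bar>w x\<bar> \<le> C" and v_le: "\<bar>v x\<bar> \<le> C" for x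
    using C C0 by (auto simp: w_def v_def)
  have w_int: "integrable (measure_pmf P) (\<lambda>z. w (x + z))" and v_int: "integrable (measure_pmf P) (\<lambda>z. v (x + z))" for x
    using w_le v_le by (auto intro!: integrable_pmf_bounded[where C = C])
  have w2_int: "integrable (measure_pmf P) (\<lambda>z. (w (x + z))\<^sup>2)" for x
    using w_le C0 by (intro integrable_pmf_bounded[where C = "C\<^sup>2"]) (auto simp: abs_le_square_iff[symmetric])
  have w2_sum: "(\<Sum>x\<in>F. (w (x + z))\<^sup>2) \<le> \<tau>" for z
  proof -
    define F' where "F' = (\<lambda>x. x + z) ` F - F"
    have "(\<Sum>x\<in>F. (w (x + z))\<^sup>2) = (\<Sum>y\<in>(\<lambda>x. x + z) ` F. (w y)\<^sup>2)"
      by (subst sum.reindex) (auto simp: inj_on_def)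
    also have "\<dots> = (\<Sum>y\<in>F'. (u y)\<^sup>2)"
      unfolding F'_def using F(1) by (intro sum.mono_neutral_cong_right) (auto simp: w_def)
    also have "\<dots> \<le> \<tau>"
      unfolding \<tau>_def F'_def using F(1)
      by (intro finite_sum_le_infsum summable_on_subset_banach[OF sq]) auto
    finally show ?thesis .
  qed
  have uE: "measure_pmf.expectation P (\<lambda>z. u (x + z))
      = (\<Sum>y\<in>F. pmf P (x - y) * u y) + measure_pmf.expectation P (\<lambda>z. w (x + z))" for x
  proof -
    have "measure_pmf.expectation P (\<lambda>z. u (x + z)) = measure_pmf.expectation P (\<lambda>z. v (x + z) + w (x + z))"
      by (intro Bochner_Integration.integral_cong) (auto simp: v_def w_def)
    also have "\<dots> = measure_pmf.expectation P (\<lambda>z. v (x + z)) + measure_pmf.expectation P (\<lambda>z. w (x + z))"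
      by (rule Bochner_Integration.integral_add[OF v_int w_int])
    also have "measure_pmf.expectation P (\<lambda>z. v (x + z)) = (\<Sum>y\<in>F. pmf P (x - y) * v y)"
      by (rule expectation_shift_finite_support[OF P F(1)]) (simp add: v_def)
    also have "\<dots> = (\<Sum>y\<in>F. pmf P (x - y) * u y)"
      by (intro sum.cong) (auto simp: v_def)
    finally show ?thesis .
  qed
  define N where "N = (\<Sum>x\<in>F. (u x)\<^sup>2)"
  define R where "R = (\<Sum>x\<in>F. u x * measure_pmf.expectation P (\<lambda>z. w (x + z)))"
  have form: "(\<Sum>x\<in>F. B x * (u x)\<^sup>2) - 2 * \<kappa> * dirichlet P F u = \<mu> * N - 2 * \<kappa> * R"
  proof -
    have "(\<Sum>x\<in>F. B x * (u x)\<^sup>2) - 2 * \<kappa> * dirichlet P F u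
        = (\<Sum>x\<in>F. u x * (2 * \<kappa> * ((\<Sum>y\<in>F. pmf P (x - y) * u y) - u x) + B x * u x))"
      by (simp add: dirichlet_def sum.distrib sum_subtractf sum_distrib_left power2_eq_square algebra_simps)
    also have "\<dots> = (\<Sum>x\<in>F. u x * (\<mu> * u x - 2 * \<kappa> * measure_pmf.expectation P (\<lambda>z. w (x + z))))"
    proof (intro sum.cong refl)
      fix x
      have "2 * \<kappa> * ((\<Sum>y\<in>F. pmf P (x - y) * u y) - u x) + B x * u x
          = \<mu> * u x - 2 * \<kappa> * measure_pmf.expectation P (\<lambda>z. w (x + z))"
        using eig[of x] unfolding uE by (simp add: algebra_simps)
      then show "u x * (2 * \<kappa> * ((\<Sum>y\<in>F. pmf P (x - y) * u y) - u x) + B x * u x)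
          = u x * (\<mu> * u x - 2 * \<kappa> * measure_pmf.expectation P (\<lambda>z. w (x + z)))"
        by simp
    qed
    also have "\<dots> = \<mu> * N - 2 * \<kappa> * R"
      by (simp add: N_def R_def sum_subtractf sum_distrib_left power2_eq_square algebra_simps)
    finally show ?thesis .
  qed
  have "2 * R = (\<Sum>x\<in>F. measure_pmf.expectation P (\<lambda>z. 2 * (u x * w (x + z))))"
    by (simp add: R_def sum_distrib_left mult.assoc)
  also have "\<dots> \<le> (\<Sum>x\<in>F. measure_pmf.expectation P (\<lambda>z. \<epsilon> * (u x)\<^sup>2 + (1 / \<epsilon>) * (w (x + z))\<^sup>2))"
  proof (intro sum_mono integral_mono)
    fix x z
    have "0 \<le> (\<epsilon> * u x - w (x + z))\<^sup>2 / \<epsilon>"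
      using \<epsilon> by simp
    then show "2 * (u x * w (x + z)) \<le> \<epsilon> * (u x)\<^sup>2 + (1 / \<epsilon>) * (w (x + z))\<^sup>2"
      using \<epsilon> by (simp add: power2_diff field_simps power2_eq_square)
  qed (use w_int w2_int in auto)
  also have "\<dots> = (\<Sum>x\<in>F. \<epsilon> * (u x)\<^sup>2 + (1 / \<epsilon>) * measure_pmf.expectation P (\<lambda>z. (w (x + z))\<^sup>2))"
    using w2_int by (intro sum.cong refl) (subst Bochner_Integration.integral_add, auto)
  also have "\<dots> = \<epsilon> * N + (1 / \<epsilon>) * measure_pmf.expectation P (\<lambda>z. \<Sum>x\<in>F. (w (x + z))\<^sup>2)"
    using w2_int by (simp add: N_def sum.distrib sum_distrib_left sum_divide_distrib)
  also have "measure_pmf.expectation P (\<lambda>z. \<Sum>x\<in>F. (w (x + z))\<^sup>2) \<le> measure_pmf.expectation P (\<lambda>z. \<tau>)"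
    using w2_int w2_sum by (intro integral_mono Bochner_Integration.integrable_sum) auto
  finally have R_le: "2 * R \<le> \<epsilon> * N + \<tau> / \<epsilon>"
    using \<epsilon> by (simp add: divide_right_mono)
  have "\<eta> \<le> N"
    unfolding \<eta>_def N_def using F by (intro member_le_sum) auto
  have "\<kappa> * \<tau> / \<epsilon> < \<mu> / 2 * \<eta>"
    using F(3) \<kappa> \<epsilon> by (simp add: \<tau>_def field_simps)
  also have "\<dots> \<le> \<mu> / 2 * N"
    using \<open>\<eta> \<le> N\<close> \<mu> by simp
  finally have "\<kappa> * \<tau> / \<epsilon> < \<mu> / 2 * N" .
  moreover have "2 * \<kappa> * R \<le> \<mu> / 2 * N + \<kappa> * \<tau> / \<epsilon>"
  proof -
    have "\<kappa> * (2 * R) \<le> \<kappa> * (\<epsilon> * N + \<tau> / \<epsilon>)"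
      using R_le \<kappa> by (intro mult_left_mono) auto
    moreover have "\<kappa> * \<epsilon> = \<mu> / 2"
      using \<kappa> by (simp add: \<epsilon>_def)
    then have "\<kappa> * (\<epsilon> * N + \<tau> / \<epsilon>) = \<mu> / 2 * N + \<kappa> * \<tau> / \<epsilon>"
      by (metis distrib_left mult.assoc times_divide_eq_right)
    ultimately show ?thesis
      by linarith
  qed
  ultimately have "0 < \<mu> * N - 2 * \<kappa> * R"
    by linarith
  then show ?thesis
    using that[OF F(1)] form by simp
qed

section \<open>Counting positive eigenvalues\<close>

lemma multiplicity_ge_1:
  assumes "f \<in> eigenspace H \<mu>" "f \<noteq> (\<lambda>_. 0)"
  shows "1 \<le> multiplicity_of H \<mu>"
proof -
  have "cfun.independent {f}"
    using assms(2) by (simp add: zero_fun_def)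
  then have "enat (card {f}) \<le> multiplicity_of H \<mu>"
    unfolding multiplicity_of_def using assms(1) by (intro SUP_upper) auto
  then show ?thesis
    by (simp add: one_enat_def)
qed

lemma multiplicity_eq_0:
  assumes "eigenspace H \<mu> \<subseteq> {\<lambda>_. 0}"
  shows "multiplicity_of H \<mu> = 0"
proof -
  have "enat (card S) \<le> 0" if "S \<subseteq> eigenspace H \<mu>" "cfun.independent S" for S
  proof -
    have "(\<lambda>_. 0) \<notin> S"
      using that(2) cfun.dependent_zero[of S] by (auto simp: zero_fun_def)
    then have "S = {}"
      using that(1) assms by blast
    then show ?thesis
      by (simp add: zero_enat_def)
  qed
  then have "multiplicity_of H \<mu> \<le> 0"
    unfolding multiplicity_of_def by (intro SUP_least) auto
  then show ?thesis
    by simp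
qed

lemma N0_ge_1:
  assumes "f \<in> eigenspace (H2 \<kappa> a B) \<mu>" "f \<noteq> (\<lambda>_. 0)" "0 < \<mu>"
  shows "1 \<le> N0 \<kappa> a B"
proof -
  have "1 \<le> multiplicity_of (H2 \<kappa> a B) \<mu>"
    using assms(1,2) by (rule multiplicity_ge_1)
  also have "\<dots> = infsum (multiplicity_of (H2 \<kappa> a B)) {\<mu>}"
    by simp
  also have "\<dots> \<le> N0 \<kappa> a B"
    unfolding N0_def using assms(3)
    by (intro infsum_mono_neutral nonneg_summable_on_complete) auto
  finally show ?thesis .
qed

lemma N0_eq_0:
  assumes "\<And>\<mu>. 0 < \<mu> \<Longrightarrow> eigenspace (H2 \<kappa> a B) \<mu> \<subseteq> {\<lambda>_. 0}"
  shows "N0 \<kappa> a B = 0"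
  unfolding N0_def using assms by (intro infsum_0 multiplicity_eq_0) auto

text \<open>
  The quadratic form of the operator with diffusion constant \<open>\<kappa>\<close> takes a positive value on some
  finitely supported function.
\<close>

definition form_positive :: "(int ^ 'd) pmf \<Rightarrow> (int ^ 'd \<Rightarrow> real) \<Rightarrow> real \<Rightarrow> bool" where
  "form_positive P B \<kappa> \<longleftrightarrow>
     (\<exists>F f. finite F \<and> 2 * \<kappa> * dirichlet P F f < (\<Sum>x\<in>F. B x * (f x)\<^sup>2))"

lemma N0_ge_1_of_form_positive:
  fixes P :: "(int ^ 'd) pmf"
  assumes P: "symmetric_pmf P" and \<kappa>: "0 < \<kappa>"
    and dirichlet_nonneg: "\<And>F f. finite F \<Longrightarrow> 0 \<le> dirichlet P F f"
    and B: "(\<lambda>x. \<bar>B x\<bar>) summable_on UNIV"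
    and pos: "form_positive P B \<kappa>"
  shows "1 \<le> N0 \<kappa> (pmf P) B"
proof -
  obtain F f where F: "finite F" "2 * \<kappa> * dirichlet P F f < (\<Sum>x\<in>F. B x * (f x)\<^sup>2)"
    using pos unfolding form_positive_def by blast
  obtain u \<mu> where u: "0 < \<mu>" "\<And>x. \<bar>u x\<bar> \<le> 1" "(\<lambda>x. (u x)\<^sup>2) summable_on UNIV" "u \<noteq> (\<lambda>_. 0)"
    "\<And>x. 2 * \<kappa> * (measure_pmf.expectation P (\<lambda>z. u (x + z)) - u x) + B x * u x = \<mu> * u x"
    using positive_eigenfunction_exists[OF P \<kappa> dirichlet_nonneg B F] by metis
  define v where "v = (\<lambda>x. complex_of_real (u x))"
  have "H2 \<kappa> (pmf P) B v x = of_real \<mu> * v x" for x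
  proof -
    have "rw_generator (pmf P) v x = measure_pmf.expectation P (\<lambda>z. v (x + z)) - v x"
      using u(2) by (intro rw_generator_expectation[where C = 1]) (simp add: v_def)
    also have "\<dots> = of_real (measure_pmf.expectation P (\<lambda>z. u (x + z)) - u x)"
      by (simp add: v_def)
    finally have "H2 \<kappa> (pmf P) B v x
        = of_real (2 * \<kappa> * (measure_pmf.expectation P (\<lambda>z. u (x + z)) - u x) + B x * u x)"
      by (simp add: H2_def v_def)
    then show ?thesis
      unfolding u(5) by (simp add: v_def)
  qed
  moreover have "v \<in> l2"
    using u(3) by (simp add: l2_def v_def)
  ultimately have "v \<in> eigenspace (H2 \<kappa> (pmf P) B) \<mu>"
    by (simp add: eigenspace_def)
  moreover have "v \<noteq> (\<lambda>_. 0)"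
    using u(4) by (auto simp: v_def fun_eq_iff)
  ultimately show ?thesis
    using u(1) by (rule N0_ge_1)
qed

text \<open>
  The operator has real coefficients, so the real and the imaginary part of an eigenfunction solve the
  eigenvalue equation, and one of them is nonzero.
\<close>

lemma N0_eq_0_of_not_form_positive:
  fixes P :: "(int ^ 'd) pmf"
  assumes P: "symmetric_pmf P" and \<kappa>: "0 < \<kappa>" and neg: "\<not> form_positive P B \<kappa>"
  shows "N0 \<kappa> (pmf P) B = 0"
proof (rule N0_eq_0, rule subsetI, rule ccontr)
  fix \<mu> :: real and f assume \<mu>: "0 < \<mu>" and f: "f \<in> eigenspace (H2 \<kappa> (pmf P) B) \<mu>"
    and "f \<notin> {\<lambda>_. 0}"
  then obtain x\<^sub>1 where x1: "f x\<^sub>1 \<noteq> 0"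
    by auto
  have sq: "(\<lambda>x. (cmod (f x))\<^sup>2) summable_on UNIV"
    using f by (simp add: eigenspace_def l2_def)
  have bound: "cmod (f x) \<le> sqrt (infsum (\<lambda>x. (cmod (f x))\<^sup>2) UNIV)" for x
    using finite_sum_le_infsum[OF sq, of "{x}"] by (intro real_le_rsqrt) simp
  have int: "integrable (measure_pmf P) (\<lambda>z. f (x + z))" for x
    using bound by (rule integrable_pmf_bounded)
  have eig: "of_real (2 * \<kappa>) * (measure_pmf.expectation P (\<lambda>z. f (x + z)) - f x) + of_real (B x) * f x
      = of_real \<mu> * f x" for x
  proof -
    have "H2 \<kappa> (pmf P) B f x = of_real \<mu> * f x"
      using f by (simp add: eigenspace_def)
    then show ?thesis
      unfolding H2_def rw_generator_expectation[of f, OF bound] .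
  qed
  have form: "form_positive P B \<kappa>" if u: "u x\<^sub>1 \<noteq> 0" "\<And>x. \<bar>u x\<bar> \<le> cmod (f x)"
    "\<And>x. 2 * \<kappa> * (measure_pmf.expectation P (\<lambda>z. u (x + z)) - u x) + B x * u x = \<mu> * u x"
  for u :: "int ^ 'd \<Rightarrow> real"
  proof -
    have "(\<lambda>x. (u x)\<^sup>2) summable_on UNIV"
      by (rule summable_on_comparison_test[OF sq]) (use u(2) in \<open>auto intro: abs_le_square_iff[THEN iffD1]\<close>)
    from quadratic_form_positive_of_eigenfunction[OF P \<kappa> \<mu> this u(1) u(3)] show ?thesis
      unfolding form_positive_def by metis
  qed
  show False
  proof (cases "Re (f x\<^sub>1) = 0")
    case False
    have "2 * \<kappa> * (measure_pmf.expectation P (\<lambda>z. Re (f (x + z))) - Re (f x)) + B x * Re (f x) = \<mu> * Re (f x)" for x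
      using arg_cong[OF eig[of x], of Re] integral_Re[OF int[of x]] by simp
    from form[OF False abs_Re_le_cmod this] show False
      using neg by blast
  next
    case True
    then have Im: "Im (f x\<^sub>1) \<noteq> 0"
      using x1 by (simp add: complex_eq_iff)
    have "2 * \<kappa> * (measure_pmf.expectation P (\<lambda>z. Im (f (x + z))) - Im (f x)) + B x * Im (f x) = \<mu> * Im (f x)" for x
      using arg_cong[OF eig[of x], of Im] integral_Im[OF int[of x]] by simp
    from form[OF Im abs_Im_le_cmod this] show False
      using neg by blast
  qed
qed

text \<open>
  The set of diffusion constants with a positive eigenvalue is an initial segment because the
  Dirichlet form is nonnegative. It is bounded because the pointwise bound gives
  \<open>(\<Sum>x\<in>F. B x * (f x)\<^sup>2) \<le> K * (\<Sum>x. \<bar>B x\<bar>) * dirichlet P F f\<close>, and it is nonempty by testing with the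
  indicator of the origin. The threshold is its supremum.
\<close>

lemma N0_threshold:
  fixes P :: "(int ^ 'd) pmf"
  assumes P: "symmetric_pmf P" and P0: "pmf P 0 = 0"
    and K: "0 < K" "\<And>F f x. finite F \<Longrightarrow> x \<in> F \<Longrightarrow> (f x)\<^sup>2 \<le> K * dirichlet P F f"
    and B: "(\<lambda>x. \<bar>B x\<bar>) summable_on UNIV" and B0: "0 < B 0"
  shows "\<exists>\<kappa>\<^sub>c\<^sub>r>0. \<forall>\<kappa>>0. (\<kappa> < \<kappa>\<^sub>c\<^sub>r \<longrightarrow> N0 \<kappa> (pmf P) B \<ge> 1) \<and> (\<kappa> > \<kappa>\<^sub>c\<^sub>r \<longrightarrow> N0 \<kappa> (pmf P) B = 0)"
proof -
  have nonneg: "0 \<le> dirichlet P F f" if "finite F" for F f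
  proof (cases "F = {}")
    case False
    then obtain x where "x \<in> F" by blast
    then have "0 \<le> K * dirichlet P F f"
      using K(2)[OF that, of x f] zero_le_power2[of "f x"] by linarith
    then show ?thesis
      using K(1) by (simp add: zero_le_mult_iff)
  qed (simp add: dirichlet_def)
  define b where "b = (\<Sum>\<^sub>\<infinity>x. \<bar>B x\<bar>)"
  define S where "S = {\<kappa>. 0 < \<kappa> \<and> form_positive P B \<kappa>}"
  have down: "\<kappa>' \<in> S" if "\<kappa> \<in> S" "0 < \<kappa>'" "\<kappa>' \<le> \<kappa>" for \<kappa> \<kappa>'
  proof -
    obtain F f where F: "finite F" "2 * \<kappa> * dirichlet P F f < (\<Sum>x\<in>F. B x * (f x)\<^sup>2)"
      using \<open>\<kappa> \<in> S\<close> by (auto simp: S_def form_positive_def)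
    have "2 * \<kappa>' * dirichlet P F f \<le> 2 * \<kappa> * dirichlet P F f"
      using that(3) nonneg[OF F(1)] by (intro mult_right_mono) auto
    then have "2 * \<kappa>' * dirichlet P F f < (\<Sum>x\<in>F. B x * (f x)\<^sup>2)"
      using F(2) by linarith
    then show ?thesis
      using that(2) F(1) by (auto simp: S_def form_positive_def)
  qed
  have upper: "\<kappa> \<le> K * b / 2" if \<kappa>: "\<kappa> \<in> S" for \<kappa>
  proof -
    obtain F f where F: "finite F" "2 * \<kappa> * dirichlet P F f < (\<Sum>x\<in>F. B x * (f x)\<^sup>2)"
      using \<kappa> by (auto simp: S_def form_positive_def)
    define D where "D = dirichlet P F f"
    have D: "0 \<le> D"
      unfolding D_def by (rule nonneg[OF F(1)])
    have "(\<Sum>x\<in>F. B x * (f x)\<^sup>2) \<le> (\<Sum>x\<in>F. \<bar>B x\<bar> * (K * D))"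
      unfolding D_def using K(2)[OF F(1)] by (intro sum_mono mult_mono) auto
    also have "\<dots> = (\<Sum>x\<in>F. \<bar>B x\<bar>) * (K * D)"
      by (simp add: sum_distrib_right)
    also have "\<dots> \<le> b * (K * D)"
    proof (rule mult_right_mono)
      show "(\<Sum>x\<in>F. \<bar>B x\<bar>) \<le> b"
        unfolding b_def using B F(1) by (intro finite_sum_le_infsum) auto
    qed (use K(1) D in auto)
    finally have "(2 * \<kappa>) * D < (K * b) * D"
      using F(2) by (simp add: D_def mult_ac)
    then have "2 * \<kappa> < K * b"
      using D by (rule mult_right_less_imp_less)
    then show ?thesis
      by simp
  qed
  have "B 0 / 4 \<in> S"
  proof -
    have "dirichlet P {0} (\<lambda>_. 1) = 1"
      using P0 by (simp add: dirichlet_def)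
    then show ?thesis
      using B0 unfolding S_def form_positive_def
      by (auto intro!: exI[of _ "{0}"] exI[of _ "\<lambda>_. 1"])
  qed
  have bdd: "bdd_above S"
    using upper by (rule bdd_aboveI)
  show ?thesis
  proof (intro exI[of _ "Sup S"] conjI allI impI)
    show "0 < Sup S"
      using cSup_upper[OF \<open>B 0 / 4 \<in> S\<close> bdd] B0 by linarith
    fix \<kappa> :: real assume \<kappa>: "0 < \<kappa>"
    {
      assume "\<kappa> < Sup S"
      then obtain \<kappa>' where "\<kappa>' \<in> S" "\<kappa> < \<kappa>'"
        using less_cSup_iff[OF _ bdd] \<open>B 0 / 4 \<in> S\<close> by blast
      then have "\<kappa> \<in> S"
        using down \<kappa> by auto
      then show "1 \<le> N0 \<kappa> (pmf P) B"
        using N0_ge_1_of_form_positive[OF P \<kappa> nonneg B] by (simp add: S_def)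
    next
      assume "Sup S < \<kappa>"
      then have "\<kappa> \<notin> S"
        using cSup_upper[OF _ bdd] by force
      then show "N0 \<kappa> (pmf P) B = 0"
        using N0_eq_0_of_not_form_positive[OF P \<kappa>] \<kappa> by (simp add: S_def)
    }
  qed
qed

theorem theorem9p6:
  fixes a b :: "int ^ 'd \<Rightarrow> real"
    and B :: "int ^ 'd \<Rightarrow> real"
    and \<alpha> \<kappa>\<^sub>0 :: real
    and M :: "'w measure"
    and X :: "real \<Rightarrow> 'w \<Rightarrow> int ^ 'd"
    and St :: "(real ^ 'd) measure"
  assumes kernel: "rw_kernel a"
    and alpha_pos: "0 < \<alpha>"
    and alpha_1: "CARD('d) = 1 \<Longrightarrow> \<alpha> < 1"
    and alpha_2: "CARD('d) \<ge> 2 \<Longrightarrow> \<alpha> < 2"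
    and kappa0_pos: "0 < \<kappa>\<^sub>0"
    and walk: "random_walk (2 * \<kappa>\<^sub>0) a M X"
    and stable: "stable_law \<alpha> St"
    and symmetric: "symmetric_law St"
    and nondegenerate: "nondegenerate_law St"
    and limit_law: "converges_in_distribution M
          (\<lambda>t \<omega>. real_vec (X t \<omega>) /\<^sub>R (t powr (1 / \<alpha>))) St"
    and b_summable: "(\<lambda>z. \<bar>b z\<bar>) summable_on UNIV"
    and B_def: "B = correlation b"
    and B_0: "B 0 > 0"
    and B_summable: "(\<lambda>x. \<bar>B x\<bar> powr (real CARD('d) / \<alpha>)) summable_on UNIV"
  shows "\<exists>\<kappa>\<^sub>c\<^sub>r>0. \<forall>\<kappa>>0.
           (\<kappa> < \<kappa>\<^sub>c\<^sub>r \<longrightarrow> N0 \<kappa> a B \<ge> 1) \<and> (\<kappa> > \<kappa>\<^sub>c\<^sub>r \<longrightarrow> N0 \<kappa> a B = 0)"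
proof -
  obtain P where P_eq: "pmf P = a"
    using rw_kernel_pmf[OF kernel] by blast
  have P: "symmetric_pmf P"
    using kernel by (simp add: symmetric_pmf_def P_eq rw_kernel_def)
  have axis_pos: "0 < pmf P (axis i 1)" for i
  proof -
    have "real_vec (axis i 1 :: int ^ 'd) = axis i 1"
      by (simp add: real_vec_def axis_def vec_eq_iff)
    then show ?thesis
      using kernel by (simp add: P_eq rw_kernel_def)
  qed
  have \<alpha>_lt: "\<alpha> < real CARD('d)"
  proof (cases "CARD('d) = 1")
    case True
    then show ?thesis
      using alpha_1 by simp
  next
    case False
    moreover have "0 < CARD('d)"
      by simp
    ultimately have "2 \<le> CARD('d)"
      by linarith
    then show ?thesis
      using alpha_2 by linarith
  qed
  have St: "prob_space St" "sets St = sets borel"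
    using stable by (auto simp: stable_law_def)
  have walk': "random_walk (2 * \<kappa>\<^sub>0) (pmf P) M X"
    using walk by (simp add: P_eq)
  have c: "0 < 2 * \<kappa>\<^sub>0"
    using kappa0_pos by simp
  have ray: "\<exists>l>0. ((\<lambda>r. symb P (r *\<^sub>R \<xi>) / r powr \<alpha>) \<longlongrightarrow> l) (at_right 0)" if "\<xi> \<noteq> 0" for \<xi>
    using symb_ray_asymptotics[OF c alpha_pos St nondegenerate
        symb_scaling_limit_cf[OF walk' P less_imp_le[OF c] limit_law] that] .
  obtain C where C: "0 < C" "\<And>\<theta>. (\<And>i. \<bar>\<theta> $ i\<bar> \<le> pi) \<Longrightarrow> C * norm \<theta> powr \<alpha> \<le> symb P \<theta>"
    using symb_lower[OF alpha_pos axis_pos ray] by metis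
  obtain K where K: "0 < K" "\<And>F f x. finite F \<Longrightarrow> x \<in> F \<Longrightarrow> (f x)\<^sup>2 \<le> K * dirichlet P F f"
    using dirichlet_pointwise_bound[OF P alpha_pos \<alpha>_lt C] by metis
  have B: "(\<lambda>x. \<bar>B x\<bar>) summable_on UNIV"
    unfolding B_def using b_summable by (rule correlation_summable)
  have "pmf P 0 = 0"
    using kernel by (simp add: P_eq rw_kernel_def)
  from N0_threshold[OF P this K B B_0] show ?thesis
    by (simp add: P_eq)
qed

end
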